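(* Let $a$ and $b$ be integers with $2\leq a\leq b\leq 2a$. If there is an integer $n$ such that $(a,b)=(3n,3n)$ or $(a,b)=(3n+1,3n+2)$, then there are exactly $(2n)!!=2^n\,n!$ tilings of the $(a,b)$-benzel by left stones, rising bones, and falling bones. Otherwise, there are no such tilings of the $(a,b)$-benzel.
   Context: Let $\omega=e^{2\pi i/3}$. The hexagonal grid is the tiling of the complex plane by regular hexagons of side length $1$ (called cells) for which one of the cells is the hexagon with vertices $1\pm 1,\ 1\pm\omega,\ 1\pm\omega^2$ (so the cell centers are the points $1+m(1-\omega)+n(1-\omega^2)$ with $m,n\in\mathbb Z$). For integers $a,b$ with $2\le a\le 2b$ and $2\le b\le 2a$, the $(a,b)$-benzel is the union of the cells lying entirely within the (closed, possibly degenerate) hexagon with vertices $a\omega+b,\ -a\omega^2-b,\ a\omega^2+b\omega,\ -a-b\omega,\ a+b\omega^2,\ -a\omega-b\omega^2$. The prototiles, each a union of three cells, are described by the centers of their cells. A left stone has centers $v-1,v-\omega,v-\omega^2$. A rising bone has centers $c-\sqrt3e^{i\pi/6},\ c,\ c+\sqrt3e^{i\pi/6}$. A falling bone has centers $c-\sqrt3e^{-i\pi/6},\ c,\ c+\sqrt3e^{-i\pi/6}$. Tiles may be translated (so that they consist of cells of the grid) but not rotated. A tiling of a region (a union of cells) by given types of tiles is a set of tiles of those types such that each cell of the region is in exactly one tile and every tile is contained in the region. Not all types of tiles need be used. *)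

theory Defs
  imports "HOL-Analysis.Analysis"
begin

definition omega :: complex where
  "omega = cis (2 * pi / 3)"

definition cell :: "complex \<Rightarrow> complex set" where
  "cell c = convex hull {c + 1, c - 1, c + omega, c - omega, c + omega^2, c - omega^2}"

definition centers :: "complex set" where
  "centers = {1 + of_int m * (1 - omega) + of_int n * (1 - omega^2) | m n :: int. True}"

definition cells :: "complex set set" where
  "cells = cell ` centers"

(* For 2 \<le> a \<le> 2b and 2 \<le> b \<le> 2a the polygon through these vertices, in this order, is
   convex (its angles are all 120 degrees, its sides have lengths 2b - a and 2a - b
   alternately), so the closed hexagon is the convex hull of its vertices. *)
definition benzel_hexagon :: "int \<Rightarrow> int \<Rightarrow> complex set" where
  "benzel_hexagon a b =
     convex hull {of_int a * omega + of_int b,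
                  - of_int a * omega^2 - of_int b,
                  of_int a * omega^2 + of_int b * omega,
                  - of_int a - of_int b * omega,
                  of_int a + of_int b * omega^2,
                  - of_int a * omega - of_int b * omega^2}"

definition benzel :: "int \<Rightarrow> int \<Rightarrow> complex set" where
  "benzel a b = \<Union> {H \<in> cells. H \<subseteq> benzel_hexagon a b}"

(* A prototile is given by the centers of its cells, up to translation. *)

definition left_stone :: "complex set" where
  "left_stone = {- 1, - omega, - (omega^2)}"

definition rising_bone :: "complex set" where
  "rising_bone = {- of_real (sqrt 3) * cis (pi / 6), 0, of_real (sqrt 3) * cis (pi / 6)}"

definition falling_bone :: "complex set" where
  "falling_bone = {- of_real (sqrt 3) * cis (- pi / 6), 0, of_real (sqrt 3) * cis (- pi / 6)}"

definition tiles :: "complex set \<Rightarrow> complex set set" where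
  "tiles P = {\<Union> (cell ` ((+) v ` P)) | v. (+) v ` P \<subseteq> centers}"

definition tilings :: "complex set set \<Rightarrow> complex set \<Rightarrow> complex set set set" where
  "tilings \<P> R = {T. T \<subseteq> (\<Union>P\<in>\<P>. tiles P) \<and> (\<forall>t\<in>T. t \<subseteq> R) \<and>
                      (\<forall>H\<in>cells. H \<subseteq> R \<longrightarrow> (\<exists>!t. t \<in> T \<and> H \<subseteq> t))}"

fun double_fact :: "nat \<Rightarrow> nat" where
  "double_fact 0 = 1"
| "double_fact (Suc 0) = 1"
| "double_fact (Suc (Suc n)) = Suc (Suc n) * double_fact n"

end

theory Submission
  imports Defs
begin

text \<open>
  Index the cell with center \<open>1 + x (1 - \<omega>) + y (1 - \<omega>\<^sup>2)\<close> by \<open>(x, y)\<close>. Falling bones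
  become horizontal and rising bones vertical trominoes, left stones become L-trominoes with their
  corner at the lower left, and exchanging \<open>x\<close> and \<open>y\<close> maps the \<open>(a, b)\<close>-benzel to the
  \<open>(b, a)\<close>-benzel. Every tile meets three consecutive diagonals \<open>y - x = c\<close>, and two of them are
  often joined rigidly: consecutive diagonals with equally many cells are matched completely by
  the tiles, so that all these cells are paired in the same direction.

  If \<open>a + b \<equiv> 1\<close> modulo 3, this already fails on the lowest diagonal. Otherwise a cell is either
  single or half of a domino, and a tile is a domino with an adjacent single; below the longest
  diagonal the dominoes have one orientation, above it the other. If \<open>a + b \<equiv> 2\<close>, the
  rightmost columns are forced, which makes too many dominoes compete for the last single
  of the longest diagonal. If \<open>a + b \<equiv> 0\<close>, put \<open>a = p + 2q\<close> and \<open>b = 2p + q\<close>. By induction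
  on \<open>r\<close>, no tile leaves the rows \<open>p - 2r\<close> and \<open>p - 2r + 1\<close> below the longest diagonal upwards.
  Each such pair of rows uses at least one of its two singles on the longest diagonal, and so does
  the pair of columns that is its mirror image above the diagonal; hence both use exactly one. This excludes \<open>p > q + 1\<close>. The \<open>r\<close>-th hook, formed by the two rows and the two
  columns, contains one left stone, which has \<open>r\<close> possible places in the rows and \<open>r\<close> in
  the columns, independently for \<open>r = 1, \<dots>, q\<close>. This gives \<open>2 \<cdot> 4 \<cdots> 2q\<close> tilings.
\<close>

section \<open>Tilings in grid coordinates\<close>

definition htile :: "int \<Rightarrow> int \<Rightarrow> (int \<times> int) set" where
  "htile x y = {(x, y), (x + 1, y), (x + 2, y)}"

definition vtile :: "int \<Rightarrow> int \<Rightarrow> (int \<times> int) set" where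
  "vtile x y = {(x, y), (x, y + 1), (x, y + 2)}"

definition ltile :: "int \<Rightarrow> int \<Rightarrow> (int \<times> int) set" where
  "ltile x y = {(x, y), (x + 1, y), (x, y + 1)}"

lemma mem_htile [simp]: "(u, v) \<in> htile x y \<longleftrightarrow> v = y \<and> x \<le> u \<and> u \<le> x + 2"
  by (auto simp: htile_def)

lemma mem_vtile [simp]: "(u, v) \<in> vtile x y \<longleftrightarrow> u = x \<and> y \<le> v \<and> v \<le> y + 2"
  by (auto simp: vtile_def)

lemma mem_ltile [simp]: "(u, v) \<in> ltile x y \<longleftrightarrow> x \<le> u \<and> y \<le> v \<and> u + v \<le> x + y + 1"
  by (auto simp: ltile_def)

definition grid_tiles :: "(int \<times> int) set set" where
  "grid_tiles = {htile x y |x y. True} \<union> {vtile x y |x y. True} \<union> {ltile x y |x y. True}"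

text \<open>The unique tile of each cell is split into covering and disjointness, the form in which
  conflicts between tiles are derived.\<close>

definition grid_tilings :: "(int \<times> int) set \<Rightarrow> (int \<times> int) set set set" where
  "grid_tilings R = {T. T \<subseteq> grid_tiles \<and> (\<forall>t\<in>T. t \<subseteq> R) \<and> R \<subseteq> \<Union>T \<and>
                      (\<forall>s\<in>T. \<forall>t\<in>T. s \<inter> t \<noteq> {} \<longrightarrow> s = t)}"

text \<open>These are the three strips bounding the hexagon, each shrunk by 1 at both ends so that a
  whole cell fits: the center \<open>pt (x, y)\<close> has strip coordinates \<open>y - x\<close>,
  \<open>1 + 2 * x + y\<close> and \<open>1 + x + 2 * y\<close>.\<close>

definition region :: "int \<Rightarrow> int \<Rightarrow> (int \<times> int) set" where
  "region a b = {(x, y). 1 - b \<le> y - x \<and> y - x \<le> a - 1 \<and> - a \<le> x + 2 * y \<and> x + 2 * y \<le> b - 2 \<and>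
                         - b \<le> 2 * x + y \<and> 2 * x + y \<le> a - 2}"

lemma mem_region:
  "(x, y) \<in> region a b \<longleftrightarrow> 1 - b \<le> y - x \<and> y - x \<le> a - 1 \<and> - a \<le> x + 2 * y \<and> x + 2 * y \<le> b - 2 \<and>
                         - b \<le> 2 * x + y \<and> 2 * x + y \<le> a - 2"
  by (simp add: region_def)

locale grid_tiling =
  fixes R T
  assumes tiling: "T \<in> grid_tilings R"
begin

lemma mem_R: "t \<in> T \<Longrightarrow> c \<in> t \<Longrightarrow> c \<in> R"
  using tiling by (simp add: grid_tilings_def) blast

lemma same_tile: "s \<in> T \<Longrightarrow> t \<in> T \<Longrightarrow> c \<in> s \<Longrightarrow> c \<in> t \<Longrightarrow> s = t"
  using tiling by (simp add: grid_tilings_def) blast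

lemma same_tile_mem: "s \<in> T \<Longrightarrow> t \<in> T \<Longrightarrow> c \<in> s \<Longrightarrow> c \<in> t \<Longrightarrow> d \<in> s \<longleftrightarrow> d \<in> t"
  using same_tile by blast

lemma covered: "c \<in> R \<Longrightarrow> \<exists>t\<in>T. c \<in> t"
proof -
  assume "c \<in> R"
  moreover have "R \<subseteq> \<Union>T" using tiling by (simp add: grid_tilings_def)
  ultimately show ?thesis by blast
qed

text \<open>The rigid link used by the forcing arguments: by disjointness, every tile contains both
  of two joined cells or neither.\<close>

definition joined :: "int \<times> int \<Rightarrow> int \<times> int \<Rightarrow> bool" where
  "joined c d \<longleftrightarrow> (\<exists>t\<in>T. c \<in> t \<and> d \<in> t)"

lemma joinedI: "t \<in> T \<Longrightarrow> c \<in> t \<Longrightarrow> d \<in> t \<Longrightarrow> joined c d"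
  by (auto simp: joined_def)

lemma joined_mem: "joined c d \<Longrightarrow> t \<in> T \<Longrightarrow> c \<in> t \<longleftrightarrow> d \<in> t"
  using same_tile unfolding joined_def by blast

lemma tile_cases:
  assumes "t \<in> T"
  obtains x y where "t = htile x y" | x y where "t = vtile x y" | x y where "t = ltile x y"
proof -
  have "T \<subseteq> grid_tiles" using tiling by (simp add: grid_tilings_def)
  then have "t \<in> grid_tiles" using assms by blast
  then show ?thesis using that unfolding grid_tiles_def by blast
qed

lemma cover_cases:
  assumes "(x, y) \<in> R"
  obtains "htile x y \<in> T" | "htile (x - 1) y \<in> T" | "htile (x - 2) y \<in> T"
    | "vtile x y \<in> T" | "vtile x (y - 1) \<in> T" | "vtile x (y - 2) \<in> T"
    | "ltile x y \<in> T" | "ltile (x - 1) y \<in> T" | "ltile x (y - 1) \<in> T"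
proof -
  obtain t where t: "t \<in> T" "(x, y) \<in> t" using covered[OF assms] by blast
  show ?thesis
    using t(1)
  proof (cases rule: tile_cases)
  case (1 u v)
    then have "u = x \<or> u = x - 1 \<or> u = x - 2" "v = y" using t(2) by auto
    then show ?thesis using that(1-3) 1 t(1) by metis
  next
    case (2 u v)
    then have "v = y \<or> v = y - 1 \<or> v = y - 2" "u = x" using t(2) by auto
    then show ?thesis using that(4-6) 2 t(1) by metis
  next
    case (3 u v)
    then have "u \<le> x" "v \<le> y" "x + y \<le> u + v + 1" using t(2) by auto
    then have "u = x \<and> v = y \<or> u = x - 1 \<and> v = y \<or> u = x \<and> v = y - 1" by linarith
    then show ?thesis using that(7-9) 3 t(1) by metis
  qed
qed

end

section \<open>Reflection exchanging the two coordinates\<close>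

lemma swap_swap_image: "prod.swap ` prod.swap ` A = A"
  by (auto simp: image_image)

lemma mem_swap_image: "(u, v) \<in> prod.swap ` t \<longleftrightarrow> (v, u) \<in> t"
  by force

lemma swap_htile: "prod.swap ` htile x y = vtile y x"
  by (auto simp: htile_def vtile_def)

lemma swap_vtile: "prod.swap ` vtile x y = htile y x"
  by (auto simp: htile_def vtile_def)

lemma swap_ltile: "prod.swap ` ltile x y = ltile y x"
  by (auto simp: ltile_def)

lemma swap_region: "prod.swap ` region a b = region b a"
proof -
  have "(x, y) \<in> prod.swap ` region a b \<longleftrightarrow> (x, y) \<in> region b a" for x y
    unfolding mem_swap_image mem_region by linarith
  then show ?thesis by auto
qed

lemma mem_image_swap_image: "t \<in> (`) prod.swap ` T \<longleftrightarrow> prod.swap ` t \<in> T"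
  by (metis (no_types, lifting) image_iff swap_swap_image)

lemma swap_grid_tiles: "t \<in> grid_tiles \<Longrightarrow> prod.swap ` t \<in> grid_tiles"
  unfolding grid_tiles_def Un_iff mem_Collect_eq by (metis swap_htile swap_vtile swap_ltile)

lemma swap_grid_tilings:
  assumes "T \<in> grid_tilings R"
  shows "(`) prod.swap ` T \<in> grid_tilings (prod.swap ` R)"
proof -
  have T: "T \<subseteq> grid_tiles" and sub: "\<forall>t\<in>T. t \<subseteq> R" and cov: "R \<subseteq> \<Union>T"
    and disj: "\<forall>s\<in>T. \<forall>t\<in>T. s \<inter> t \<noteq> {} \<longrightarrow> s = t"
    using assms by (simp_all add: grid_tilings_def)
  have "(`) prod.swap ` T \<subseteq> grid_tiles"
    using T swap_grid_tiles by blast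
  moreover have "\<forall>t\<in>(`) prod.swap ` T. t \<subseteq> prod.swap ` R"
    using sub by (simp add: image_mono)
  moreover have "prod.swap ` R \<subseteq> \<Union>((`) prod.swap ` T)"
    using image_mono[OF cov, of prod.swap] by (simp add: image_Union)
  moreover have "\<forall>s\<in>(`) prod.swap ` T. \<forall>t\<in>(`) prod.swap ` T. s \<inter> t \<noteq> {} \<longrightarrow> s = t"
    using disj by (simp add: image_Int[symmetric]) blast
  ultimately show ?thesis unfolding grid_tilings_def mem_Collect_eq by (intro conjI)
qed

section \<open>From cells in the plane to grid coordinates\<close>

lemma omega_eq: "omega = Complex (- 1 / 2) (sqrt 3 / 2)"
  by (simp add: omega_def complex_eq_iff cos_120 sin_120)

lemma omega_sq: "omega\<^sup>2 = Complex (- 1 / 2) (- sqrt 3 / 2)"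
  by (simp add: omega_eq power2_eq_square complex_eq_iff)

lemma norm_omega: "norm omega = 1" "norm (omega\<^sup>2) = 1"
  by (simp_all add: omega_def norm_power)

(* u and w are, up to the scale factor 2 / sqrt 3, the coordinates of a point along the normals
   to two of the three directions of cell edges; u + w is the coordinate along the third one. *)
definition point :: "real \<Rightarrow> real \<Rightarrow> complex" where
  "point u w = Complex (w + u / 2) (sqrt 3 / 2 * u)"

definition pt :: "int \<times> int \<Rightarrow> complex" where
  "pt c = point (snd c - fst c) (1 + 2 * fst c + snd c)"

lemma point_add: "point u w + point u' w' = point (u + u') (w + w')"
  by (simp add: point_def complex_eq_iff algebra_simps)

lemma point_diff: "point u w - point u' w' = point (u - u') (w - w')"
  by (simp add: point_def complex_eq_iff algebra_simps diff_divide_distrib)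

lemma point_minus: "- point u w = point (- u) (- w)"
  by (simp add: point_def complex_eq_iff)

lemma point_scale: "of_real t * point u w = point (t * u) (t * w)"
  "of_int n * point u w = point (n * u) (n * w)"
  by (simp_all add: point_def complex_eq_iff algebra_simps)

lemma basic_points: "1 = point 0 1" "omega = point 1 (- 1)" "omega\<^sup>2 = point (- 1) 0"
proof -
  show "omega\<^sup>2 = point (- 1) 0" unfolding omega_sq by (simp add: point_def)
qed (simp_all add: point_def omega_eq complex_eq_iff)

lemma root3_points:
  "of_real (sqrt 3) * cis (pi / 6) = point 1 1" "of_real (sqrt 3) * cis (- pi / 6) = point (- 1) 2"
  by (simp_all add: point_def complex_eq_iff cos_30 sin_30)

lemma point_eq_iff: "point u w = point u' w' \<longleftrightarrow> u = u' \<and> w = w'"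
  by (auto simp: point_def)

lemma norm_point: "(norm (point u w))\<^sup>2 = u\<^sup>2 + u * w + w\<^sup>2"
  by (simp add: point_def cmod_power2 power_mult_distrib power_divide power2_sum field_simps)

lemma pt_alt: "pt (x, y) = 1 + of_int x * (1 - omega) + of_int y * (1 - omega\<^sup>2)"
  unfolding basic_points(3) unfolding basic_points(1,2) point_diff point_scale point_add pt_def by (simp add: point_eq_iff)

lemma centers_eq: "centers = range pt"
proof -
  have "centers = {pt (m, n) |m n. True}" unfolding centers_def pt_alt ..
  then show ?thesis by auto
qed

lemma cell_point: "cell (point u w) = convex hull {point u (w + 1), point u (w - 1), point (u + 1) (w - 1),
    point (u - 1) (w + 1), point (u - 1) w, point (u + 1) w}"
  unfolding cell_def basic_points(3) unfolding basic_points(1,2) point_diff point_add by (simp add: insert_commute)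

section \<open>Cells are determined by their centers\<close>

lemma center_in_cell: "c \<in> cell c"
proof -
  have "(1 / 2) *\<^sub>R (c + 1) + (1 / 2) *\<^sub>R (c - 1) \<in> cell c"
    unfolding cell_def by (intro convexD[OF convex_convex_hull] hull_inc) simp_all
  moreover have "(1 / 2) *\<^sub>R (c + 1) + (1 / 2) *\<^sub>R (c - 1) = c" by (simp add: complex_eq_iff field_simps)
  ultimately show ?thesis by simp
qed

lemma cell_subset_cball: "cell c \<subseteq> cball c 1"
  unfolding cell_def by (rule hull_minimal) (auto simp: dist_norm norm_omega)

text \<open>A cell lies in the unit disc around its center, whereas the squared distance of two
  centers is \<open>3 * Q\<close> for an integer \<open>Q\<close>; so \<open>Q \<le> 0\<close>, and
  the form \<open>Q\<close> is positive definite.\<close>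

lemma pt_in_cell_iff: "pt c \<in> cell (pt d) \<longleftrightarrow> c = d"
proof
  assume "pt c \<in> cell (pt d)"
  obtain x y where c: "c = (x, y)" by (cases c)
  obtain x' y' where d: "d = (x', y')" by (cases d)
  define i j where "i = x' - x" and "j = y' - y"
  define Q where "Q = i\<^sup>2 + i * j + j\<^sup>2"
  have "norm (pt d - pt c) \<le> 1"
    using subsetD[OF cell_subset_cball \<open>pt c \<in> cell (pt d)\<close>] by (simp add: dist_norm)
  then have "(norm (pt d - pt c))\<^sup>2 \<le> 1" by (simp add: power_le_one)
  moreover have "(norm (pt d - pt c))\<^sup>2 = 3 * real_of_int Q"
  proof -
    have "pt d - pt c = point (j - i) (2 * i + j)"
      by (simp add: c d pt_def point_diff point_eq_iff i_def j_def)
    then have "(norm (pt d - pt c))\<^sup>2 = (j - i)\<^sup>2 + (j - i) * (2 * i + j) + (2 * i + j)\<^sup>2"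
      by (simp only: norm_point) simp
    then show ?thesis by (simp add: Q_def power2_eq_square algebra_simps)
  qed
  ultimately have "Q \<le> 0" by linarith
  moreover have "2 * Q = i\<^sup>2 + j\<^sup>2 + (i + j)\<^sup>2"
    by (simp add: Q_def power2_eq_square algebra_simps)
  moreover have "0 \<le> i\<^sup>2" "0 \<le> j\<^sup>2" "0 \<le> (i + j)\<^sup>2" by simp_all
  ultimately have "i\<^sup>2 = 0" "j\<^sup>2 = 0" by linarith+
  then have "i = 0" "j = 0" by simp_all
  then have "x = x'" "y = y'" by (simp_all add: i_def j_def)
  then show "c = d" by (simp add: c d)
qed (simp add: center_in_cell)

definition cell_union :: "(int \<times> int) set \<Rightarrow> complex set" where
  "cell_union A = \<Union> (cell ` pt ` A)"

lemma pt_in_cell_union: "pt c \<in> cell_union A \<longleftrightarrow> c \<in> A"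
  by (auto simp: cell_union_def pt_in_cell_iff)

lemma cell_subset_cell_union: "cell (pt c) \<subseteq> cell_union A \<longleftrightarrow> c \<in> A"
  using center_in_cell[of "pt c"] pt_in_cell_union[of c A] by (auto simp: cell_union_def)

lemma cell_union_subset: "cell_union A \<subseteq> cell_union B \<longleftrightarrow> A \<subseteq> B"
proof
  assume sub: "cell_union A \<subseteq> cell_union B"
  show "A \<subseteq> B"
  proof
    fix c assume "c \<in> A"
    then have "pt c \<in> cell_union B" using sub pt_in_cell_union[of c A] by blast
    then show "c \<in> B" by (simp add: pt_in_cell_union)
  qed
qed (auto simp: cell_union_def)

lemma cell_union_inj: "cell_union A = cell_union B \<longleftrightarrow> A = B"
  by (metis cell_union_subset subset_antisym order_refl)

lemma convex_segment:
  fixes C :: "complex set"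
  assumes "convex C" "point (u\<^sub>0 + s * u\<^sub>1) (w\<^sub>0 + s * w\<^sub>1) \<in> C" "point (u\<^sub>0 + t * u\<^sub>1) (w\<^sub>0 + t * w\<^sub>1) \<in> C" "s \<le> r" "r \<le> t"
  shows "point (u\<^sub>0 + r * u\<^sub>1) (w\<^sub>0 + r * w\<^sub>1) \<in> C"
proof (cases "s = t")
  case True
  then show ?thesis using assms by simp
next
  case False
  then have "s < t" using assms by simp
  define v where "v = (r - s) / (t - s)"
  have v: "0 \<le> v" "v \<le> 1" using assms \<open>s < t\<close> by (auto simp: v_def field_simps)
  have "v * (t - s) = r - s" using \<open>s < t\<close> by (simp add: v_def)
  then have r: "r = (1 - v) * s + v * t" by (simp add: algebra_simps)
  have "(1 - v) *\<^sub>R point (u\<^sub>0 + s * u\<^sub>1) (w\<^sub>0 + s * w\<^sub>1) + v *\<^sub>R point (u\<^sub>0 + t * u\<^sub>1) (w\<^sub>0 + t * w\<^sub>1) \<in> C"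
    using assms v by (intro convexD) auto
  then show ?thesis
    unfolding scaleR_conv_of_real point_scale point_add r by (simp add: algebra_simps)
qed

section \<open>The hexagon as an intersection of three strips\<close>

lemma benzel_hexagon_vertices:
  "benzel_hexagon a b = convex hull {point a (b - a), point a (- b), point (b - a) (- b),
     point (- b) (b - a), point (- b) a, point (b - a) a}"
proof -
  have "of_int a * omega + of_int b = point a (b - a)"
    "- of_int a - of_int b * omega = point (- b) (b - a)"
    by (simp_all add: point_def omega_eq complex_eq_iff field_simps)
  moreover have "- of_int a * omega\<^sup>2 - of_int b = point a (- b)"
    "of_int a + of_int b * omega\<^sup>2 = point (- b) a"
    unfolding omega_sq by (simp_all add: point_def complex_eq_iff field_simps)
  moreover have "of_int a * omega\<^sup>2 + of_int b * omega = point (b - a) (- b)"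
    "- of_int a * omega - of_int b * omega\<^sup>2 = point (b - a) a"
    unfolding omega_sq by (simp_all add: point_def omega_eq complex_eq_iff field_simps)
  ultimately show ?thesis unfolding benzel_hexagon_def by simp
qed

text \<open>The strips are convex and contain the vertices. Conversely, a point of all three strips
  lies on the chord at its level \<open>w\<close>, whose ends lie on sides of the hexagon.\<close>

lemma mem_benzel_hexagon:
  fixes a b :: int and u w :: real
  assumes ab: "a \<le> 2 * b" "b \<le> 2 * a"
  shows "point u w \<in> benzel_hexagon a b \<longleftrightarrow>
    - b \<le> u \<and> u \<le> a \<and> - b \<le> w \<and> w \<le> a \<and> - a \<le> u + w \<and> u + w \<le> b"
proof
  let ?U = "\<lambda>z. 2 / sqrt 3 * Im z" and ?W = "\<lambda>z. Re z - Im z / sqrt 3" and ?V = "\<lambda>z. Re z + Im z / sqrt 3"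
  let ?S = "?U -` {- b..a} \<inter> ?W -` {- b..a} \<inter> ?V -` {- a..b}"
  have lin: "linear ?U" "linear ?W" "linear ?V"
    by (auto intro!: linearI simp: field_simps)
  have pt: "?U (point u w) = u" "?W (point u w) = w" "?V (point u w) = u + w" for u w
    by (simp_all add: point_def field_simps)
  have cvS: "convex ?S"
    by (intro convex_Int convex_linear_vimage lin convex_real_interval)
  have vertices: "{point a (b - a), point a (- b), point (b - a) (- b),
     point (- b) (b - a), point (- b) a, point (b - a) a} \<subseteq> ?S"
    using ab unfolding insert_subset Int_iff vimage_eq pt by simp
  have sub: "benzel_hexagon a b \<subseteq> ?S"
    unfolding benzel_hexagon_vertices using vertices cvS by (rule hull_minimal)
  assume "point u w \<in> benzel_hexagon a b"
  then have "point u w \<in> ?S" by (rule subsetD[OF sub])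
  then show "- b \<le> u \<and> u \<le> a \<and> - b \<le> w \<and> w \<le> a \<and> - a \<le> u + w \<and> u + w \<le> b"
    unfolding Int_iff vimage_eq pt by simp
next
  let ?C = "benzel_hexagon a b"
  assume b: "- b \<le> u \<and> u \<le> a \<and> - b \<le> w \<and> w \<le> a \<and> - a \<le> u + w \<and> u + w \<le> b"
  have cv: "convex ?C" by (simp add: benzel_hexagon_def)
  have vert: "point a (b - a) \<in> ?C" "point a (- b) \<in> ?C" "point (b - a) (- b) \<in> ?C"
     "point (- b) (b - a) \<in> ?C" "point (- b) a \<in> ?C" "point (b - a) a \<in> ?C"
    unfolding benzel_hexagon_vertices by (auto intro: hull_inc)
  show "point u w \<in> ?C"
  \<comment> \<open>The level \<open>b - a\<close> carries two opposite vertices; there both ends of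
    the chord pass to other sides.\<close>
  proof (cases "w \<le> b - a")
    case True
    have "point a w \<in> ?C"
      using convex_segment[OF cv, of a "- b" 0 0 1 "b - a" w] vert b True by simp
    moreover have "point (- a - w) w \<in> ?C"
      using convex_segment[OF cv, of "- a" "- b" "- 1" 0 1 "b - a" w] vert b True by simp
    ultimately show ?thesis
      using convex_segment[OF cv, of 0 "- a - w" 1 w 0 a u] b by simp
  next
    case False
    have "point (- b) w \<in> ?C"
      using convex_segment[OF cv, of "- b" "b - a" 0 0 1 a w] vert b False by simp
    moreover have "point (b - w) w \<in> ?C"
      using convex_segment[OF cv, of b "b - a" "- 1" 0 1 a w] vert b False by simp
    ultimately show ?thesis
      using convex_segment[OF cv, of 0 "- b" 1 w 0 "b - w" u] b by simp
  qed
qed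

lemma cell_subset_hexagon:
  assumes "a \<le> 2 * b" "b \<le> 2 * a"
  shows "cell (pt c) \<subseteq> benzel_hexagon a b \<longleftrightarrow> c \<in> region a b"
proof -
  obtain x y where c: "c = (x, y)" by (cases c)
  have cv: "convex (benzel_hexagon a b)" by (simp add: benzel_hexagon_def)
  have hull: "convex hull V \<subseteq> benzel_hexagon a b \<longleftrightarrow> V \<subseteq> benzel_hexagon a b" for V
  proof
    show "convex hull V \<subseteq> benzel_hexagon a b" if "V \<subseteq> benzel_hexagon a b"
      using that cv by (rule hull_minimal)
    show "V \<subseteq> benzel_hexagon a b" if "convex hull V \<subseteq> benzel_hexagon a b"
      using hull_subset that by (rule subset_trans)
  qed
  show ?thesis
    unfolding c pt_def cell_point hull insert_subset fst_conv snd_conv mem_region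
    unfolding mem_benzel_hexagon[OF assms]
    by (intro iffI; elim conjE; intro conjI empty_subsetI; linarith)
qed

lemma benzel_eq:
  assumes "a \<le> 2 * b" "b \<le> 2 * a"
  shows "benzel a b = cell_union (region a b)"
proof -
  have "{H \<in> cells. H \<subseteq> benzel_hexagon a b} = cell ` pt ` region a b"
    using cell_subset_hexagon[OF assms] unfolding cells_def centers_eq by auto
  then show ?thesis by (simp add: benzel_def cell_union_def)
qed

text \<open>The offset \<open>d\<close> of one cell of the prototile locates the translate. It is
  needed because the reference point of a left stone is the common vertex of its cells, not a
  center.\<close>

lemma tiles_eqI:
  assumes ex: "\<And>v. v + d \<in> centers \<Longrightarrow> \<exists>x y. (+) v ` P = pt ` f x y" and d: "d \<in> P"
    and ex': "\<And>x y. \<exists>v. (+) v ` P = pt ` f x y"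
  shows "tiles P = cell_union ` {f x y |x y. True}"
proof
  show "tiles P \<subseteq> cell_union ` {f x y |x y. True}"
  proof
    fix t assume "t \<in> tiles P"
    then obtain v where v: "t = \<Union> (cell ` ((+) v ` P))" "(+) v ` P \<subseteq> centers"
      unfolding tiles_def by blast
    then have "v + d \<in> centers" using d by blast
    from ex[OF this] obtain x y where "(+) v ` P = pt ` f x y" by (elim exE)
    then have "t = cell_union (f x y)" unfolding v(1) cell_union_def by simp
    then show "t \<in> cell_union ` {f x y |x y. True}" by blast
  qed
  show "cell_union ` {f x y |x y. True} \<subseteq> tiles P"
  proof
    fix t assume "t \<in> cell_union ` {f x y |x y. True}"
    then obtain x y where t: "t = cell_union (f x y)" by blast
    obtain v where v: "(+) v ` P = pt ` f x y" using ex'[of x y] by (elim exE)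
    then have "t = \<Union> (cell ` ((+) v ` P)) \<and> (+) v ` P \<subseteq> centers"
      unfolding t cell_union_def centers_eq by auto
    then show "t \<in> tiles P" unfolding tiles_def by blast
  qed
qed

lemma tiles_left_stone: "tiles left_stone = cell_union ` {ltile x y |x y. True}"
proof (rule tiles_eqI[where d = "- 1"])
  have key: "(+) (pt (x, y) + 1) ` left_stone = pt ` ltile x y" for x y
    unfolding left_stone_def ltile_def image_insert image_empty pt_def basic_points(3) unfolding basic_points(1,2) point_minus point_add
    by (simp add: insert_commute algebra_simps)
  show "\<exists>x y. (+) v ` left_stone = pt ` ltile x y" if v: "v + - 1 \<in> centers" for v
  proof -
    obtain c where "v + - 1 = pt c" using v unfolding centers_eq by (elim rangeE)
    then have "v = pt (fst c, snd c) + 1" by (simp add: algebra_simps)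
    then show ?thesis using key by blast
  qed
  show "\<exists>v. (+) v ` left_stone = pt ` ltile x y" for x y using key by blast
qed (simp add: left_stone_def)

lemma tiles_rising_bone: "tiles rising_bone = cell_union ` {vtile x y |x y. True}"
proof (rule tiles_eqI[where d = 0])
  have key: "(+) (pt (x, y + 1)) ` rising_bone = pt ` vtile x y" for x y
    unfolding rising_bone_def vtile_def image_insert image_empty pt_def root3_points mult_minus_left point_minus point_add
    by (simp add: point_add algebra_simps)
  show "\<exists>x y. (+) v ` rising_bone = pt ` vtile x y" if v: "v + 0 \<in> centers" for v
  proof -
    obtain c where "v + 0 = pt c" using v unfolding centers_eq by (elim rangeE)
    then have "v = pt (fst c, (snd c - 1) + 1)" by simp
    then show ?thesis using key by blast
  qed
  show "\<exists>v. (+) v ` rising_bone = pt ` vtile x y" for x y using key by blast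
qed (simp add: rising_bone_def)

lemma tiles_falling_bone: "tiles falling_bone = cell_union ` {htile x y |x y. True}"
proof (rule tiles_eqI[where d = 0])
  have key: "(+) (pt (x + 1, y)) ` falling_bone = pt ` htile x y" for x y
    unfolding falling_bone_def htile_def image_insert image_empty pt_def root3_points mult_minus_left point_minus point_add
    by (simp add: point_add algebra_simps)
  show "\<exists>x y. (+) v ` falling_bone = pt ` htile x y" if v: "v + 0 \<in> centers" for v
  proof -
    obtain c where "v + 0 = pt c" using v unfolding centers_eq by (elim rangeE)
    then have "v = pt ((fst c - 1) + 1, snd c)" by simp
    then show ?thesis using key by blast
  qed
  show "\<exists>v. (+) v ` falling_bone = pt ` htile x y" for x y using key by blast
qed (simp add: falling_bone_def)

lemma prototiles_eq: "(\<Union>P\<in>{left_stone, rising_bone, falling_bone}. tiles P) = cell_union ` grid_tiles"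
  by (simp add: tiles_left_stone tiles_rising_bone tiles_falling_bone grid_tiles_def image_Un Un_ac)

text \<open>\<open>cell_union\<close> is injective and reflects inclusion, so grid tilings and
  geometric tilings translate into each other tile by tile.\<close>

lemma tilings_eq:
  assumes "a \<le> 2 * b" "b \<le> 2 * a"
  shows "tilings {left_stone, rising_bone, falling_bone} (benzel a b)
    = (`) cell_union ` grid_tilings (region a b)" (is "?A = ?B")
proof
  let ?R = "region a b"
  have A: "T \<in> ?A \<longleftrightarrow> T \<subseteq> cell_union ` grid_tiles \<and> (\<forall>t\<in>T. t \<subseteq> cell_union ?R) \<and>
      (\<forall>c\<in>?R. \<exists>!t. t \<in> T \<and> cell (pt c) \<subseteq> t)" for T
  proof -
    have aux: "(\<forall>H\<in>cell ` range pt. H \<subseteq> cell_union ?R \<longrightarrow> Q H) \<longleftrightarrow> (\<forall>c\<in>?R. Q (cell (pt c)))" for Q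
      by (auto simp: cell_subset_cell_union)
    show ?thesis
      unfolding tilings_def prototiles_eq benzel_eq[OF assms] cells_def centers_eq mem_Collect_eq aux ..
  qed
  show "?A \<subseteq> ?B"
  proof
    fix T assume "T \<in> ?A"
    then have T: "T \<subseteq> cell_union ` grid_tiles" "\<forall>t\<in>T. t \<subseteq> cell_union ?R" 
      and ex: "\<forall>c\<in>?R. \<exists>!t. t \<in> T \<and> cell (pt c) \<subseteq> t" unfolding A by simp_all
    define S where "S = {A \<in> grid_tiles. cell_union A \<in> T}"
    have TS: "T = cell_union ` S" using T(1) by (auto simp: S_def)
    have sub: "\<forall>t\<in>S. t \<subseteq> ?R" using T(2) unfolding S_def cell_union_subset[symmetric] by blast
    have "\<exists>t\<in>S. c \<in> t" if c: "c \<in> ?R" for c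
    proof -
      obtain t where "t \<in> T" "cell (pt c) \<subseteq> t" using bspec[OF ex c] by (elim ex1E conjE)
      then show ?thesis unfolding TS by (auto simp: cell_subset_cell_union)
    qed
    then have cov: "?R \<subseteq> \<Union>S" by blast
    have same: "s = t" if "s \<in> S" "t \<in> S" "c \<in> s" "c \<in> t" for s t c
    proof -
      have "c \<in> ?R" using sub that by blast
      have "cell_union s = cell_union t"
      proof (rule ex1E[OF bspec[OF ex \<open>c \<in> ?R\<close>]])
        fix r assume "\<forall>y. y \<in> T \<and> cell (pt c) \<subseteq> y \<longrightarrow> y = r"
        then have "\<And>A. A \<in> S \<Longrightarrow> c \<in> A \<Longrightarrow> cell_union A = r" by (simp add: S_def cell_subset_cell_union)
        then show ?thesis using that by simp
      qed
      then show ?thesis by (simp add: cell_union_inj)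
    qed
    have "\<forall>s\<in>S. \<forall>t\<in>S. s \<inter> t \<noteq> {} \<longrightarrow> s = t"
    proof (intro ballI impI)
      fix s t assume "s \<in> S" "t \<in> S" "s \<inter> t \<noteq> {}"
      then obtain c where "c \<in> s" "c \<in> t" by blast
      then show "s = t" by (rule same[OF \<open>s \<in> S\<close> \<open>t \<in> S\<close>])
    qed
    moreover have "S \<subseteq> grid_tiles" unfolding S_def by (rule Collect_restrict)
    ultimately have "S \<in> grid_tilings ?R"
      using sub cov unfolding grid_tilings_def mem_Collect_eq by (intro conjI)
    then show "T \<in> ?B" unfolding TS by (rule imageI)
  qed
  show "?B \<subseteq> ?A"
  proof
    fix T assume "T \<in> ?B"
    then obtain S where S: "S \<in> grid_tilings ?R" and TS: "T = cell_union ` S" by blast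
    interpret grid_tiling ?R S using S by unfold_locales
    have "S \<subseteq> grid_tiles" "\<forall>t\<in>S. t \<subseteq> ?R" using S by (simp_all add: grid_tilings_def)
    moreover have "\<exists>!t. t \<in> T \<and> cell (pt c) \<subseteq> t" if c: "c \<in> ?R" for c
    proof -
      obtain t where t: "t \<in> S" "c \<in> t" using covered[OF c] by blast
      show ?thesis
      proof (rule ex1I[of _ "cell_union t"])
        show "cell_union t \<in> T \<and> cell (pt c) \<subseteq> cell_union t" using t by (simp add: TS cell_subset_cell_union)
        show "r = cell_union t" if r: "r \<in> T \<and> cell (pt c) \<subseteq> r" for r
        proof -
          obtain s where "s \<in> S" "r = cell_union s" using r TS by blast
          then show ?thesis using r t same_tile[of s t c] by (simp add: cell_subset_cell_union)
        qed
      qed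
    qed
    ultimately show "T \<in> ?A" unfolding A by (auto simp: TS cell_union_subset)
  qed
qed

lemma card_tilings:
  assumes "a \<le> 2 * b" "b \<le> 2 * a"
  shows "card (tilings {left_stone, rising_bone, falling_bone} (benzel a b)) = card (grid_tilings (region a b))"
proof -
  have "inj_on ((`) cell_union) (grid_tilings (region a b))"
    by (rule inj_onI) (simp add: inj_image_eq_iff inj_def cell_union_inj)
  then show ?thesis by (simp add: tilings_eq[OF assms] card_image)
qed

section \<open>The case \<open>a + b \<equiv> 1\<close> modulo 3\<close>

text \<open>Each cell of the lowest diagonal is forced to share its tile with its left neighbour,
  but the left neighbour of the last one lies outside the region.\<close>

lemma no_tiling_mod1:
  fixes a b k :: int
  assumes ab: "a + b = 3 * k + 1" "b \<le> 2 * a" "a \<le> 2 * b" "2 \<le> a" "2 \<le> b" and T: "T \<in> grid_tilings (region a b)"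
  shows False
proof -
  interpret grid_tiling "region a b" T using T by unfold_locales
  have ka: "k \<le> a - 1" "a \<le> 2 * b - 1" using ab by presburger+
  \<comment> \<open>The cells \<open>(x i, y i)\<close> descend the lowest diagonal
    \<open>y - x = 1 - b\<close> from its upper end.\<close>
  define x y where "x = (\<lambda>i::nat. k - 1 - int i)" and "y = (\<lambda>i::nat. a - 2 * k - 1 - int i)"
  have left: "joined (x i, y i) (x i - 1, y i)" if "int i < a - k" for i
    using that
  proof (induction i)
    case (0)
    have R: "(x 0, y 0) \<in> region a b" and out: "(x 0 + 1, y 0) \<notin> region a b" "(x 0, y 0 - 1) \<notin> region a b"
      "(x 0, y 0 + 2) \<notin> region a b"
      using 0 ab ka by (simp_all add: mem_region x_def y_def)
    from R show ?case
      by (cases rule: cover_cases) (auto intro: joinedI dest: mem_R[where c = "(x 0 + 1, y 0)"]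
         mem_R[where c = "(x 0, y 0 - 1)"] mem_R[where c = "(x 0, y 0 + 2)"] simp: out)
  next
    case (Suc i)
    have R: "(x (Suc i), y (Suc i)) \<in> region a b" and out: "(x (Suc i) + 1, y (Suc i)) \<notin> region a b" "(x (Suc i), y (Suc i) - 1) \<notin> region a b"
      using Suc.prems ab ka by (simp_all add: mem_region x_def y_def)
    \<comment> \<open>The cell above the present one is already joined to the preceding cell of the
      diagonal, so the present tile cannot contain it.\<close>
    have j: "joined (x (Suc i) + 1, y (Suc i) + 1) (x (Suc i), y (Suc i) + 1)" 
      using Suc by (simp add: x_def y_def algebra_simps)
    from R show ?case
      by (cases rule: cover_cases) (auto intro: joinedI dest: mem_R[where c = "(x (Suc i) + 1, y (Suc i))"]
         mem_R[where c = "(x (Suc i), y (Suc i) - 1)"] joined_mem[OF j] simp: out)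
  qed
  have "joined (2 * k - a, - k) (2 * k - a - 1, - k)"
    using left[of "nat (a - k - 1)"] ka by (simp add: x_def y_def)
  moreover have "(2 * k - a - 1, - k) \<notin> region a b" using ab by (simp add: mem_region)
  ultimately show False using mem_R unfolding joined_def by blast
qed

section \<open>The case \<open>a + b \<equiv> 2\<close> modulo 3\<close>

text \<open>
  Here \<open>(i, m)\<close> stands for the domino \<open>(m, Y i m)\<close>, \<open>(m, Y i m + 1)\<close>, with \<open>Y\<close> as defined below.
\<close>

definition columns :: "int \<Rightarrow> int \<Rightarrow> (int \<times> int) set" where
  "columns p q = {(i, m). 1 \<le> i \<and> i \<le> p \<and> 2 * i - p - 1 \<le> m \<and> m \<le> q + i - 1}"

lemma mem_columns: "(i, m) \<in> columns p q \<longleftrightarrow> 1 \<le> i \<and> i \<le> p \<and> 2 * i - p - 1 \<le> m \<and> m \<le> q + i - 1"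
  by (simp add: columns_def)

locale tiling_mod2 = grid_tiling "region (p + 2 * q + 1) (2 * p + q + 1)" T for p q :: int and T +
  assumes p_pos: "1 \<le> p" and q_nonneg: "0 \<le> q"
begin

definition Y :: "int \<Rightarrow> int \<Rightarrow> int" where
  "Y i m = m + p - q - 3 * i + 1"

text \<open>The pairs of diagonals are treated from the lowest upwards, each from its left end. A
  tile through the lower cell that misses the upper one would leave the region or cut a domino glued
  before: the left neighbour in the same pair, or one in the next lower pair.\<close>

lemma glued:
  assumes "(i, m) \<in> columns p q"
  shows "joined (m, Y i m) (m, Y i m + 1)"
  using assms
proof (induction "nat (p - i)" arbitrary: i m rule: less_induct)
  case less
  note outer = less.hyps
  from less.prems show ?case
  proof (induction "nat (m - (2 * i - p - 1))" arbitrary: m rule: less_induct)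
    case less
    note inner = less.hyps
    let ?y = "Y i m"
    have v: "1 \<le> i" "i \<le> p" "2 * i - p - 1 \<le> m" "m \<le> q + i - 1"
      using less.prems by (simp_all add: mem_columns)
    have R: "(m, ?y) \<in> region (p + 2 * q + 1) (2 * p + q + 1)"
      using v q_nonneg by (simp add: mem_region Y_def)
    have left: "(m - 1, ?y - 1) \<in> t" if "t \<in> T" "(m - 1, ?y) \<in> t" for t
    proof -
      have "2 * i - p - 1 \<le> m - 1" using mem_R[OF that] by (simp add: mem_region Y_def)
      then have "(i, m - 1) \<in> columns p q" "nat (m - 1 - (2 * i - p - 1)) < nat (m - (2 * i - p - 1))"
        using v by (simp_all add: mem_columns)
      from inner[OF this(2,1)] have "joined (m - 1, Y i (m - 1)) (m - 1, Y i (m - 1) + 1)" .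
      moreover have "Y i (m - 1) = ?y - 1" by (simp add: Y_def)
      ultimately have "joined (m - 1, ?y - 1) (m - 1, ?y)" by simp
      then show ?thesis using joined_mem that by blast
    qed
    have down: "(u, v - 1) \<in> t" if "t \<in> T" "(u, v) \<in> t" "v - u = ?y - m - 2" for t u v
    proof -
      have "(u, v) \<in> region (p + 2 * q + 1) (2 * p + q + 1)" using mem_R that by blast
      then have "i + 1 \<le> p" "2 * (i + 1) - p - 1 \<le> u" "u \<le> q + (i + 1) - 1"
        using that(3) by (simp_all add: mem_region Y_def)
      then have "(i + 1, u) \<in> columns p q" "nat (p - (i + 1)) < nat (p - i)"
        using v by (simp_all add: mem_columns)
      from outer[OF this(2,1)] have "joined (u, Y (i + 1) u) (u, Y (i + 1) u + 1)" .
      moreover have "Y (i + 1) u = v - 1" using that(3) by (simp add: Y_def)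
      ultimately have "joined (u, v - 1) (u, v)" by simp
      then show ?thesis using joined_mem that by blast
    qed
    show "joined (m, ?y) (m, ?y + 1)"
      using R
    proof (cases rule: cover_cases)
      case 1
      then show ?thesis using down[OF 1, of "m + 2" ?y] by simp
    next
      case 2
      then show ?thesis using left[OF 2] by simp
    next
      case 3
      then show ?thesis using left[OF 3] by simp
    next
      case 6
      then show ?thesis using down[OF 6, of m "?y - 2"] by simp
    next
      case 8
      then show ?thesis using left[OF 8] by simp
    next
      case 9
      then show ?thesis using down[OF 9, of "m + 1" "?y - 1"] by simp
    qed (auto intro: joinedI)
  qed
qed

lemma column_cases:
  assumes "(i, m) \<in> columns p q"
  obtains "vtile m (Y i m) \<in> T" | "vtile m (Y i m - 1) \<in> T" | "ltile m (Y i m) \<in> T"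
proof -
  have j: "joined (m, Y i m) (m, Y i m + 1)" by (rule glued[OF assms])
  then have "(m, Y i m) \<in> region (p + 2 * q + 1) (2 * p + q + 1)"
    using mem_R unfolding joined_def by blast
  then show ?thesis
  proof (cases rule: cover_cases)
    case 4
    then show ?thesis by (rule that(1))
  next
    case 5
    then show ?thesis by (rule that(2))
  next
    case 7
    then show ?thesis by (rule that(3))
  qed (use joined_mem[OF j] in fastforce)+
qed

text \<open>Columns \<open>m \<ge> q\<close> do not meet the longest diagonal, so their top domino
  cannot go up. Taking them from the right and each from the top, the single above a domino is used
  by the next domino of the column and the single to its right by the next column; only down
  remains.\<close>

lemma right_columns:
  assumes "(i, m) \<in> columns p q" "q \<le> m"
  shows "vtile m (Y i m - 1) \<in> T"
  using assms
proof (induction "nat (p + q - m)" arbitrary: i m rule: less_induct)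
  case less
  note outer = less.hyps
  from less.prems show ?case
  proof (induction "nat i" arbitrary: i rule: less_induct)
    case less
    note v = less.prems(1)[unfolded mem_columns]
    show ?case
      using less.prems(1)
    proof (cases rule: column_cases)
      case 1
      then have "m \<le> q + (i - 1) - 1" using mem_R[OF 1, of "(m, Y i m + 2)"] v by (simp add: mem_region Y_def)
      then have "(i - 1, m) \<in> columns p q" "nat (i - 1) < nat i"
        using v less.prems(2) by (simp_all add: mem_columns)
      from less.hyps[OF this(2,1)] less.prems(2) have "vtile m (Y i m + 2) \<in> T"
        by (simp add: Y_def algebra_simps)
      then show ?thesis
        using same_tile_mem[OF 1, of "vtile m (Y i m + 2)" "(m, Y i m + 2)" "(m, Y i m)"] by simp
    next
      case 3
      then have "m + 1 \<le> q + i - 1" using mem_R[OF 3, of "(m + 1, Y i m)"] v by (simp add: mem_region Y_def)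
      then have "(i, m + 1) \<in> columns p q" "nat (p + q - (m + 1)) < nat (p + q - m)"
        using v less.prems(2) by (simp_all add: mem_columns)
      from outer[OF this(2,1)] less.prems(2) have "vtile (m + 1) (Y i m) \<in> T"
        by (simp add: Y_def algebra_simps)
      then show ?thesis
        using same_tile_mem[OF 3, of "vtile (m + 1) (Y i m)" "(m + 1, Y i m)" "(m, Y i m)"] by simp
    qed
  qed
qed

lemma last_not_down: "vtile (p - 1) (Y p (p - 1) - 1) \<notin> T"
proof
  assume "vtile (p - 1) (Y p (p - 1) - 1) \<in> T"
  then have "(p - 1, Y p (p - 1) - 1) \<in> region (p + 2 * q + 1) (2 * p + q + 1)"
    by (rule mem_R) simp
  then show False by (simp add: mem_region Y_def)
qed

text \<open>Otherwise column \<open>p - 1\<close> is among those forced downwards, against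
  \<open>last_not_down\<close>.\<close>

lemma p_le_q: "p \<le> q"
  using right_columns[of p "p - 1"] last_not_down p_pos q_nonneg by (force simp: mem_columns)

text \<open>In column \<open>p - 1\<close> the lowest domino cannot go down, and the singles to the
  right are used by column \<open>p\<close>. So each domino goes up and pushes the next one up,
  until the topmost takes \<open>(p - 1, p - 1)\<close>, the last single of the longest
  diagonal.\<close>

lemma diagonal_column:
  assumes "p = q"
  shows "vtile (p - 1) (p - 3) \<in> T"
proof -
  have "vtile (p - 1) (Y i (p - 1)) \<in> T" if "i \<le> p" "1 \<le> i" for i
    using that
  proof (induction i rule: int_le_induct)
    case base
    have "(p, p - 1) \<in> columns p q" using p_pos q_nonneg by (simp add: mem_columns)
    then show ?case
    proof (cases rule: column_cases)
      case 2
      then show ?thesis using last_not_down by simp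
    next
      case 3
      have "(p, p) \<in> columns p q" using p_pos assms by (simp add: mem_columns)
      then have "vtile p (Y p p - 1) \<in> T" using right_columns[of p p] assms by simp
      moreover have "Y p p - 1 = Y p (p - 1)" by (simp add: Y_def)
      ultimately have "vtile p (Y p (p - 1)) \<in> T" by simp
      then show ?thesis
        using same_tile_mem[OF 3, of "vtile p (Y p (p - 1))" "(p, Y p (p - 1))" "(p - 1, Y p (p - 1))"] by simp
    qed
  next
    case (step i)
    let ?y = "Y (i - 1) (p - 1)"
    have y: "Y i (p - 1) = ?y - 3" by (simp add: Y_def)
    have "(i - 1, p - 1) \<in> columns p q" using step assms by (simp add: mem_columns)
    then show ?case
    proof (cases rule: column_cases)
      case 2
      have "vtile (p - 1) (?y - 3) \<in> T" using step y by simp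
      then show ?thesis
        using same_tile_mem[OF 2, of "vtile (p - 1) (?y - 3)" "(p - 1, ?y - 1)" "(p - 1, ?y)"] by simp
    next
      case 3
      have "(i - 1, p) \<in> columns p q" using step assms by (simp add: mem_columns)
      then have "vtile p (Y (i - 1) p - 1) \<in> T" using right_columns[of "i - 1" p] assms by simp
      moreover have "Y (i - 1) p - 1 = ?y" by (simp add: Y_def)
      ultimately have "vtile p ?y \<in> T" by simp
      then show ?thesis
        using same_tile_mem[OF 3, of "vtile p ?y" "(p, ?y)" "(p - 1, ?y)"] by simp
    qed
  qed
  moreover have "Y 1 (p - 1) = p - 3" unfolding Y_def using assms by simp
  ultimately show ?thesis using p_pos by force
qed

end

lemma no_tiling_mod2:
  fixes p q :: int
  assumes "1 \<le> p" "0 \<le> q" "q \<le> p" and T: "T \<in> grid_tilings (region (p + 2 * q + 1) (2 * p + q + 1))"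
  shows False
proof -
  interpret L: tiling_mod2 p q T using assms by unfold_locales
  have "p = q" using L.p_le_q assms by simp
  \<comment> \<open>For \<open>p = q\<close> the region is its own reflection, and the tiling and
    its reflection yield two different bones through \<open>(p - 1, p - 1)\<close>.\<close>
  let ?S = "(`) prod.swap ` T"
  have "?S \<in> grid_tilings (region (p + 2 * q + 1) (2 * p + q + 1))"
    using swap_grid_tilings[OF T] \<open>p = q\<close> by (simp add: swap_region)
  then interpret H: tiling_mod2 p q ?S using assms by unfold_locales
  have "vtile (p - 1) (p - 3) \<in> T" "htile (p - 3) (p - 1) \<in> T"
    using L.diagonal_column[OF \<open>p = q\<close>] H.diagonal_column[OF \<open>p = q\<close>]
    by (simp_all add: mem_image_swap_image swap_vtile)
  then show False
    using L.same_tile_mem[of "vtile (p - 1) (p - 3)" "htile (p - 3) (p - 1)" "(p - 1, p - 1)" "(p - 2, p - 1)"] by simp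
qed

section \<open>The case \<open>a + b \<equiv> 0\<close> modulo 3: forced structure\<close>

text \<open>
  The index \<open>(i, n)\<close> stands for the domino \<open>(X i n - 2, n)\<close>, \<open>(X i n - 1, n)\<close>, with \<open>X\<close> as defined
  below. The singles are the cells \<open>(X i n, n)\<close>; those with \<open>i = 0\<close> form the longest diagonal
  \<open>y - x = p - q\<close>. Only the half below this diagonal is described; the other half is the same for
  the reflected tiling, with \<open>p\<close> and \<open>q\<close> exchanged.
\<close>

definition dominoes :: "int \<Rightarrow> int \<Rightarrow> (int \<times> int) set" where
  "dominoes p q = {(i, n). 1 \<le> i \<and> i \<le> p \<and> 1 - q - i \<le> n \<and> n \<le> p - 2 * i}"

lemma mem_dominoes: "(i, n) \<in> dominoes p q \<longleftrightarrow> 1 \<le> i \<and> i \<le> p \<and> 1 - q - i \<le> n \<and> n \<le> p - 2 * i"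
  by (simp add: dominoes_def)

locale tiling_mod0 = grid_tiling "region (p + 2 * q) (2 * p + q)" T for p q :: int and T +
  assumes p_nonneg: "0 \<le> p" and q_nonneg: "0 \<le> q"
begin

abbreviation "D \<equiv> dominoes p q"

definition X :: "int \<Rightarrow> int \<Rightarrow> int" where
  "X i n = n - p + q + 3 * i"

lemma X_shift: "X (i + 1) n = X i n + 3" "X i (n + 1) = X i n + 1"
  by (simp_all add: X_def)

text \<open>Pairs of diagonals are again treated from the lowest upwards, now each from its upper
  end; every unwanted tile would leave the region or cut a domino glued before.\<close>

lemma glued:
  assumes "(i, n) \<in> D"
  shows "joined (X i n - 1, n) (X i n - 2, n)"
  using assms
proof (induction "nat (p - i)" arbitrary: i n rule: less_induct)
  case less
  note outer = less.hyps
  from less.prems show ?case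
  proof (induction "nat (p - 2 * i - n)" arbitrary: n rule: less_induct)
    case less
    note inner = less.hyps
    let ?x = "X i n - 1"
    have v: "1 \<le> i" "i \<le> p" "1 - q - i \<le> n" "n \<le> p - 2 * i"
      using less.prems by (simp_all add: mem_dominoes)
    have R: "(?x, n) \<in> region (p + 2 * q) (2 * p + q)"
      using v p_nonneg q_nonneg by (simp add: mem_region X_def)
    have up: "(?x, n + 1) \<in> t \<Longrightarrow> (?x + 1, n + 1) \<in> t" if "t \<in> T" for t
    proof -
      assume t: "(?x, n + 1) \<in> t"
      then have "n + 1 \<le> p - 2 * i" using mem_R[OF that t] by (simp add: mem_region X_def)
      then have "(i, n + 1) \<in> D" "nat (p - 2 * i - (n + 1)) < nat (p - 2 * i - n)"
        using v by (simp_all add: mem_dominoes)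
      from inner[OF this(2,1)] have "joined (?x + 1, n + 1) (?x, n + 1)"
        by (simp add: X_def algebra_simps)
      then show ?thesis using joined_mem t that by blast
    qed
    have right: "(u + 1, v) \<in> t" if "t \<in> T" "(u, v) \<in> t" "u - v = ?x - n + 2" for t u v
    proof -
      have "(u, v) \<in> region (p + 2 * q) (2 * p + q)" using mem_R that by blast
      then have "i + 1 \<le> p" "1 - q - (i + 1) \<le> v" "v \<le> p - 2 * (i + 1)"
        using that(3) by (simp_all add: mem_region X_def)
      then have "(i + 1, v) \<in> D" "nat (p - (i + 1)) < nat (p - i)"
        using v by (simp_all add: mem_dominoes)
      from outer[OF this(2,1)] have "joined (X (i + 1) v - 1, v) (X (i + 1) v - 2, v)" .
      moreover have "X (i + 1) v - 1 = u + 1" "X (i + 1) v - 2 = u" using that(3) by (simp_all add: X_def)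
      ultimately have "joined (u + 1, v) (u, v)" by simp
      then show ?thesis using joined_mem that by blast
    qed
    have "joined (?x, n) (?x - 1, n)"
      using R
    proof (cases rule: cover_cases)
      case 1
      then show ?thesis using right[OF 1, of "?x + 2" n] by simp
    next
      case 4
      then show ?thesis using up[OF 4] by simp
    next
      case 5
      then show ?thesis using up[OF 5] by simp
    next
      case 6
      then show ?thesis using right[OF 6, of ?x "n - 2"] by simp
    next
      case 7
      then show ?thesis using up[OF 7] by simp
    next
      case 9
      then show ?thesis using right[OF 9, of "?x + 1" "n - 1"] by simp
    qed (auto intro: joinedI)
    then show ?case by simp
  qed
qed

text \<open>The three ways to complete a domino to a tile. With \<open>(i, n)\<close> as the index
  of the single \<open>(X i n, n)\<close>, they use the singles \<open>(i - 1, n)\<close>,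
  \<open>(i, n)\<close> and \<open>(i - 1, n + 1)\<close> in this order.\<close>

definition "Lf i n \<longleftrightarrow> htile (X i n - 3) n \<in> T"
definition "Rt i n \<longleftrightarrow> htile (X i n - 2) n \<in> T"
definition "Up i n \<longleftrightarrow> ltile (X i n - 2) n \<in> T"

lemma domino_cases:
  assumes "(i, n) \<in> D"
  obtains "Lf i n" | "Up i n" | "Rt i n"
proof -
  have j: "joined (X i n - 1, n) (X i n - 2, n)" by (rule glued[OF assms])
  then have "(X i n - 1, n) \<in> region (p + 2 * q) (2 * p + q)"
    using mem_R unfolding joined_def by blast
  then show ?thesis
  proof (cases rule: cover_cases)
    case 2
    then show ?thesis using that(3) by (simp add: Rt_def)
  next
    case 3
    then show ?thesis using that(1) by (simp add: Lf_def)
  next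
    case 8
    then show ?thesis using that(2) by (simp add: Up_def)
  qed (use joined_mem[OF j] in fastforce)+
qed

text \<open>The first three hold because a domino lies in one tile only, the last three because a
  single does.\<close>

lemma conflicts:
  shows "Lf i n \<Longrightarrow> Rt i n \<Longrightarrow> False"
    and "Lf i n \<Longrightarrow> Up i n \<Longrightarrow> False"
    and "Up i n \<Longrightarrow> Rt i n \<Longrightarrow> False"
    and "Rt i n \<Longrightarrow> Lf (i + 1) n \<Longrightarrow> False"
    and "Up (i + 1) n \<Longrightarrow> Rt i (n + 1) \<Longrightarrow> False"
    and "Up i n \<Longrightarrow> Lf i (n + 1) \<Longrightarrow> False"
proof -
  show "Lf i n \<Longrightarrow> Rt i n \<Longrightarrow> False"
    using same_tile_mem[of "htile (X i n - 3) n" "htile (X i n - 2) n" "(X i n - 2, n)" "(X i n, n)"]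
    by (simp add: Lf_def Rt_def X_def)
  show "Lf i n \<Longrightarrow> Up i n \<Longrightarrow> False"
    using same_tile_mem[of "htile (X i n - 3) n" "ltile (X i n - 2) n" "(X i n - 2, n)" "(X i n - 3, n)"]
    by (simp add: Lf_def Up_def X_def)
  show "Up i n \<Longrightarrow> Rt i n \<Longrightarrow> False"
    using same_tile_mem[of "htile (X i n - 2) n" "ltile (X i n - 2) n" "(X i n - 2, n)" "(X i n, n)"]
    by (simp add: Rt_def Up_def X_def)
  show "Rt i n \<Longrightarrow> Lf (i + 1) n \<Longrightarrow> False"
    using same_tile_mem[of "htile (X i n - 2) n" "htile (X i n) n" "(X i n, n)" "(X i n - 1, n)"]
    by (simp add: Lf_def Rt_def X_shift)
  show "Up (i + 1) n \<Longrightarrow> Rt i (n + 1) \<Longrightarrow> False"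
    using same_tile_mem[of "ltile (1 + X i n) n" "htile (X i n - 1) (n + 1)" "(X i n + 1, n + 1)" "(X i n, n + 1)"]
    by (simp add: Up_def Rt_def X_shift)
  show "Up i n \<Longrightarrow> Lf i (n + 1) \<Longrightarrow> False"
    using same_tile_mem[of "ltile (X i n - 2) n" "htile (X i n - 2) (n + 1)" "(X i n - 2, n + 1)" "(X i n - 1, n + 1)"]
    by (simp add: Up_def Lf_def X_shift)
qed

lemma Rt_bound: "Rt i n \<Longrightarrow> n \<le> p - 2 * i - 1 \<and> i \<le> p - 1"
  using mem_R[of "htile (X i n - 2) n" "(X i n, n)"] by (simp add: Rt_def mem_region X_def)

text \<open>A domino going left takes the single that its left neighbour needs for going right. So,
  where no left stone intervenes, the direction propagates along the row.\<close>

lemma lefts: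
  assumes "(i, n) \<in> D" "(j, n) \<in> D" "i \<le> j" "\<not> Rt j n" "\<forall>l. i \<le> l \<and> l \<le> j \<longrightarrow> \<not> Up l n"
  shows "Lf i n"
  using assms(3,1,5)
proof (induction i rule: int_le_induct)
  case base
  show ?case using assms(4) base(2) by (cases rule: domino_cases[OF assms(2)]) auto
next
  case (step i)
  then have v: "(i, n) \<in> D" using assms(2) by (auto simp: mem_dominoes)
  then have "Lf i n" using step by auto
  then have "\<not> Rt (i - 1) n" using conflicts(4)[of "i - 1" n] by auto
  moreover have "\<not> Up (i - 1) n" using step by simp
  ultimately show ?case by (cases rule: domino_cases[OF step.prems(1)]) auto
qed

lemma rights:
  assumes "(i, n) \<in> D" "(j, n) \<in> D" "i \<le> j" "\<not> Lf i n" "\<forall>l. i \<le> l \<and> l \<le> j \<longrightarrow> \<not> Up l n"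
  shows "Rt j n"
  using assms(3,2,5)
proof (induction j rule: int_ge_induct)
  case base
  show ?case using assms(4) base(2) by (cases rule: domino_cases[OF assms(1)]) auto
next
  case (step j)
  then have v: "(j, n) \<in> D" using assms(1) by (auto simp: mem_dominoes)
  then have "Rt j n" using step by auto
  then have "\<not> Lf (j + 1) n" using conflicts(4)[of j n] by auto
  moreover have "\<not> Up (j + 1) n" using step by simp
  ultimately show ?case by (cases rule: domino_cases[OF step.prems(1)]) auto
qed

text \<open>The single \<open>(X 0 n, n)\<close> of the longest diagonal is covered from below.\<close>

definition "peak n \<longleftrightarrow> Lf 1 n \<or> Up 1 (n - 1)"

text \<open>\<open>k\<close> is the position of the left stone joining the rows \<open>y\<close> and
  \<open>y + 1\<close>, with \<open>k = 0\<close> if there is none. The other dominoes point towards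
  it in row \<open>y\<close> and away from it in row \<open>y + 1\<close>.\<close>

definition block_form :: "int \<Rightarrow> int \<Rightarrow> int \<Rightarrow> bool" where
  "block_form r y k \<longleftrightarrow>
    (\<forall>i. 1 \<le> i \<and> i \<le> r \<longrightarrow> (i < k \<longrightarrow> Rt i y) \<and> (i = k \<longrightarrow> Up i y) \<and> (k < i \<longrightarrow> Lf i y)) \<and>
    (\<forall>i. 1 \<le> i \<and> i < r \<longrightarrow> (i < k \<longrightarrow> Lf i (y + 1)) \<and> (k \<le> i \<longrightarrow> Rt i (y + 1)))"

definition "noup n \<longleftrightarrow> (\<forall>i. (i, n) \<in> D \<longrightarrow> \<not> Up i n)"

text \<open>The last domino of row \<open>y\<close> cannot go right. Without a left stone the whole
  row goes left and takes its peak. A left stone at \<open>k\<close> splits row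
  \<open>y + 1\<close>, and that peak is taken by the left part or, for \<open>k = 1\<close>, by the
  stone. If only one peak is taken, all remaining directions are forced.\<close>

lemma block:
  assumes r: "1 \<le> r" "r \<le> p" "- q \<le> p - 2 * r" and y: "y = p - 2 * r" and noup: "noup (y + 1)"
  shows "peak y \<or> peak (y + 1)"
    and "\<not> (peak y \<and> peak (y + 1)) \<Longrightarrow> \<exists>k. 0 \<le> k \<and> k \<le> r \<and> block_form r y k \<and> (k = 0 \<longleftrightarrow> peak y)"
proof -
  have dom: "(i, y) \<in> D \<longleftrightarrow> 1 \<le> i \<and> i \<le> r" "(i, y + 1) \<in> D \<longleftrightarrow> 1 \<le> i \<and> i < r" for i
    using r y by (auto simp: mem_dominoes)
  have noup1: "\<not> Up i (y + 1)" if "1 \<le> i" "i < r" for i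
    using noup that dom by (auto simp: noup_def)
  have notRt: "\<not> Rt r y" using Rt_bound[of r y] y by auto
  have "(peak y \<or> peak (y + 1)) \<and>
    (\<not> (peak y \<and> peak (y + 1)) \<longrightarrow> (\<exists>k. 0 \<le> k \<and> k \<le> r \<and> block_form r y k \<and> (k = 0 \<longleftrightarrow> peak y)))"
  proof (cases "\<exists>k. 1 \<le> k \<and> k \<le> r \<and> Up k y")
    case False
    then have L: "Lf i y" if "1 \<le> i" "i \<le> r" for i
      using lefts[of i y r] that r notRt by (auto simp: dom)
    then have "peak y" using r by (simp add: peak_def)
    moreover have "block_form r y 0" if "\<not> peak (y + 1)"
    proof -
      have "Rt i (y + 1)" if "1 \<le> i" "i < r" for i
        using rights[of 1 "y + 1" i] that noup1 \<open>\<not> peak (y + 1)\<close> by (auto simp: dom peak_def)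
      then show ?thesis using L by (auto simp: block_form_def)
    qed
    ultimately show ?thesis using r by (metis order_refl order_trans zero_le_one)
  next
    case True
    then obtain k where k: "1 \<le> k" "k \<le> r" "Up k y" by blast
    have "\<not> Rt (k - 1) (y + 1)" using conflicts(5)[of "k - 1" y] k by auto
    then have TL: "Lf i (y + 1)" if "1 \<le> i" "i < k" for i
      using lefts[of i "y + 1" "k - 1"] that k noup1 by (auto simp: dom)
    have TR: "Rt i (y + 1)" if "k \<le> i" "i < r" for i
      using rights[of k "y + 1" i] that k noup1 conflicts(6)[of k y] by (auto simp: dom)
    \<comment> \<open>A second left stone would need a single of row \<open>y + 1\<close> that is
      already taken.\<close>
    have uniq: "\<not> Up l y" if "1 \<le> l" "l \<le> r" "l \<noteq> k" for l
    proof (cases "l < k")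
      case True
      then show ?thesis using TL[of l] that conflicts(6)[of l y] by auto
    next
      case False
      then show ?thesis using TR[of "l - 1"] that conflicts(5)[of "l - 1" y] by auto
    qed
    have peak: "peak (y + 1)"
      using k TL[of 1] by (cases "k = 1") (auto simp: peak_def)
    moreover have "block_form r y k" if "\<not> peak y"
    proof -
      have "Rt i y" if "1 \<le> i" "i < k" for i
        using rights[of 1 y i] that k uniq \<open>\<not> peak y\<close> by (auto simp: dom peak_def)
      moreover have "Lf i y" if "k < i" "i \<le> r" for i
        using lefts[of i y r] that k uniq notRt by (auto simp: dom)
      ultimately show ?thesis using k TL TR by (auto simp: block_form_def)
    qed
    ultimately show ?thesis using k by (metis not_one_le_zero order_trans zero_le_one)
  qed
  then show "peak y \<or> peak (y + 1)"
    and "\<not> (peak y \<and> peak (y + 1)) \<Longrightarrow> \<exists>k. 0 \<le> k \<and> k \<le> r \<and> block_form r y k \<and> (k = 0 \<longleftrightarrow> peak y)"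
    by blast+
qed

text \<open>The single needed by a left stone at \<open>(i, y - 1)\<close> is taken by a domino of
  row \<open>y\<close>, except if \<open>i = 1 \<le> k\<close>; then the stone would create the
  excluded peak of row \<open>y\<close>.\<close>

lemma noup_below_block:
  assumes r: "1 \<le> r" "r \<le> p" and y: "y = p - 2 * r" and form: "block_form r y k" and k: "k = 0 \<or> \<not> peak y"
  shows "noup (y - 1)"
  unfolding noup_def
proof (intro allI impI notI)
  fix i assume "(i, y - 1) \<in> D" and up: "Up i (y - 1)"
  then have i: "1 \<le> i" "i \<le> r" using y by (auto simp: mem_dominoes)
  show False
  proof (cases "k < i")
    case True
    then have "Lf i y" using form i by (simp add: block_form_def)
    then show False using conflicts(6)[of i "y - 1"] up by simp
  next
    case False
    show False
    proof (cases "i = 1")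
      case True
      then show False using k up False by (auto simp: peak_def)
    next
      case 2: False
      then have "Rt (i - 1) y" using form i False by (simp add: block_form_def)
      then show False using conflicts(5)[of "i - 1" "y - 1"] up by simp
    qed
  qed
qed

text \<open>Rows \<open>n \<le> - p\<close> end on the lowest pair of diagonals, where no domino can
  go right; without left stones the whole row goes left.\<close>

lemma rim_row:
  assumes "noup n" "n \<le> - p" "(i, n) \<in> D"
  shows "Lf i n"
proof (rule lefts[of i n p])
  show "(p, n) \<in> D" "i \<le> p" "\<not> Rt p n" using assms Rt_bound[of p n] by (auto simp: mem_dominoes)
  show "\<forall>l. i \<le> l \<and> l \<le> p \<longrightarrow> \<not> Up l n" using assms by (auto simp: mem_dominoes noup_def)
qed fact

text \<open>A row going left as a whole takes every single that a left stone of the row below would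
  need.\<close>

lemma noup_rim:
  assumes "noup m" "m \<le> - p" "n \<le> m"
  shows "noup n"
  using assms(3,1,2)
proof (induction n rule: int_le_induct)
  case base
  then show ?case by simp
next
  case (step n)
  have "\<not> Up i (n - 1)" if "(i, n - 1) \<in> D" for i
  proof -
    have "(i, n) \<in> D" using that step by (auto simp: mem_dominoes)
    then have "Lf i n" using rim_row step by simp
    then show ?thesis using conflicts(6)[of i "n - 1"] by auto
  qed
  then show ?case by (simp add: noup_def)
qed

lemma peak_imp_pos: "peak n \<Longrightarrow> 0 < q"
proof -
  assume "peak n"
  then have "htile (n - p + q) n \<in> T \<or> ltile (n - p + q) (n - 1) \<in> T"
    by (simp add: peak_def Lf_def Up_def X_def algebra_simps)
  then have "(n - p + q, n) \<in> region (p + 2 * q) (2 * p + q)"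
    using mem_R[of _ "(n - p + q, n)"] by fastforce
  then show "0 < q" by (simp add: mem_region)
qed

end

section \<open>Interaction of the two halves along the longest diagonal\<close>

lemma tiling_mod0_swap:
  assumes "tiling_mod0 p q T"
  shows "tiling_mod0 q p ((`) prod.swap ` T)"
proof -
  interpret tiling_mod0 p q T by fact
  have "(`) prod.swap ` T \<in> grid_tilings (region (q + 2 * p) (2 * q + p))"
    using swap_grid_tilings[OF tiling] by (simp add: swap_region add.commute)
  then show ?thesis using p_nonneg q_nonneg by unfold_locales
qed

locale mirrored_tiling_mod0 = L: tiling_mod0 p q T + H: tiling_mod0 q p "(`) prod.swap ` T" for p q T
begin

text \<open>Both peaks mean the same single, covered from below and, in the reflected tiling, from
  the other side.\<close>

lemma peaks: "L.peak n \<Longrightarrow> H.peak (n - p + q) \<Longrightarrow> False"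
proof -
  let ?m = "n - p + q"
  assume "L.peak n" "H.peak (n - p + q)"
  then have "htile ?m n \<in> T \<or> ltile ?m (n - 1) \<in> T" "vtile ?m n \<in> T \<or> ltile (?m - 1) n \<in> T"
    by (simp_all add: L.peak_def L.Lf_def L.Up_def L.X_def H.peak_def H.Lf_def H.Up_def H.X_def
        mem_image_swap_image swap_htile swap_ltile algebra_simps)
  then show False
    using L.same_tile_mem[of "htile ?m n" "vtile ?m n" "(?m, n)" "(?m + 1, n)"]
      L.same_tile_mem[of "htile ?m n" "ltile (?m - 1) n" "(?m, n)" "(?m + 2, n)"]
      L.same_tile_mem[of "ltile ?m (n - 1)" "vtile ?m n" "(?m, n)" "(?m, n - 1)"]
      L.same_tile_mem[of "ltile ?m (n - 1)" "ltile (?m - 1) n" "(?m, n)" "(?m, n - 1)"]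
    by auto
qed

text \<open>The \<open>r\<close>-th pairs of rows and of columns meet the longest diagonal in the
  same two singles. By \<open>block\<close> each half takes at least one, so by \<open>peaks\<close>
  exactly one. Both halves then have a \<open>block_form\<close>, just one of them with a left
  stone, and the induction can pass to the next pair.\<close>

lemma blocks:
  assumes "0 \<le> r" "r \<le> p" "r \<le> q"
  shows "L.noup (p - 2 * r - 1) \<and> H.noup (q - 2 * r - 1) \<and>
    (\<forall>s. 1 \<le> s \<and> s \<le> r \<longrightarrow> (\<exists>k k'. 0 \<le> k \<and> k \<le> s \<and> 0 \<le> k' \<and> k' \<le> s \<and>
        L.block_form s (p - 2 * s) k \<and> H.block_form s (q - 2 * s) k' \<and> (k = 0 \<longleftrightarrow> k' \<noteq> 0)))"
  using assms
proof (induction r rule: int_ge_induct)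
  case base
  \<comment> \<open>The rows \<open>p - 1\<close> and \<open>q - 1\<close> contain no
    dominoes.\<close>
  show ?case by (auto simp: L.noup_def H.noup_def mem_dominoes)
next
  case (step r)
  let ?r = "r + 1"
  let ?y = "p - 2 * ?r" and ?z = "q - 2 * ?r"
  have r: "1 \<le> ?r" "?r \<le> p" "?r \<le> q" "- q \<le> ?y" "- p \<le> ?z" using step by auto
  have IH: "L.noup (?y + 1)" "H.noup (?z + 1)" and forms: "\<forall>s. 1 \<le> s \<and> s \<le> r \<longrightarrow> (\<exists>k k'. 0 \<le> k \<and> k \<le> s \<and> 0 \<le> k' \<and> k' \<le> s \<and>
        L.block_form s (p - 2 * s) k \<and> H.block_form s (q - 2 * s) k' \<and> (k = 0 \<longleftrightarrow> k' \<noteq> 0))"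
    using step by (simp_all add: algebra_simps)
  have ex: "\<not> (L.peak ?y \<and> H.peak ?z)" "\<not> (L.peak (?y + 1) \<and> H.peak (?z + 1))"
    using peaks[of ?y] peaks[of "?y + 1"] by (auto simp: algebra_simps)
  note Lb = L.block[OF r(1,2,4) refl IH(1)] and Hb = H.block[OF r(1,3,5) refl IH(2)]
  obtain k where k: "0 \<le> k" "k \<le> ?r" "L.block_form ?r ?y k" "k = 0 \<longleftrightarrow> L.peak ?y"
    using Lb ex Hb(1) by blast
  obtain k' where k': "0 \<le> k'" "k' \<le> ?r" "H.block_form ?r ?z k'" "k' = 0 \<longleftrightarrow> H.peak ?z"
    using Hb ex Lb(1) by blast
  have kk: "k = 0 \<longleftrightarrow> k' \<noteq> 0" using k(4) k'(4) ex Lb(1) Hb(1) by blast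
  have "L.noup (?y - 1)" using L.noup_below_block[OF r(1,2) refl k(3)] k(4) by blast
  moreover have "H.noup (?z - 1)" using H.noup_below_block[OF r(1,3) refl k'(3)] k'(4) by blast
  moreover have "\<exists>k k'. 0 \<le> k \<and> k \<le> s \<and> 0 \<le> k' \<and> k' \<le> s \<and>
        L.block_form s (p - 2 * s) k \<and> H.block_form s (q - 2 * s) k' \<and> (k = 0 \<longleftrightarrow> k' \<noteq> 0)"
    if "1 \<le> s" "s \<le> ?r" for s
  proof (cases "s = ?r")
    case True
    then show ?thesis using k k' kk by blast
  next
    case False
    then show ?thesis using forms that by simp
  qed
  ultimately show ?case by blast
qed

text \<open>If \<open>p \<ge> q + 2\<close>, a further pair of rows remains after \<open>q\<close>
  hooks and needs a single of the longest diagonal by \<open>block\<close>. In the other half only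
  rim rows remain there, and these take both singles. For \<open>q = 0\<close> the diagonal lies
  outside the region.\<close>

lemma upper_bound:
  assumes "2 \<le> p + 2 * q"
  shows "p \<le> q + 1"
proof (rule ccontr)
  assume "\<not> p \<le> q + 1"
  then have pq: "q + 2 \<le> p" by simp
  have noup: "L.noup (p - 2 * q - 1)" "H.noup (- q - 1)"
    using blocks[of q] L.q_nonneg pq by auto
  have "\<not> L.peak (p - 2 * q - 2 + j)" if "j = 0 \<or> j = 1" for j
  proof (cases "q = 0")
    case True
    then show ?thesis using L.peak_imp_pos by blast
  next
    case False
    let ?n = "- q - 2 + j"
    have "(1, ?n) \<in> H.D" using False L.q_nonneg pq that by (auto simp: mem_dominoes)
    moreover have "H.noup ?n" by (rule H.noup_rim[OF noup(2)]) (use that in auto)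
    ultimately have "H.Lf 1 ?n" using H.rim_row that by auto
    then have "H.peak ?n" by (simp add: H.peak_def)
    then show ?thesis using peaks[of "p - 2 * q - 2 + j"] by (auto simp: algebra_simps)
  qed
  from this[of 0] this[of 1] show False
    using L.block(1)[of "q + 1" "p - 2 * q - 2"] noup(1) L.q_nonneg pq by (simp add: algebra_simps)
qed

end

section \<open>The case \<open>a + b \<equiv> 0\<close> modulo 3: construction of the tilings\<close>

text \<open>
  \<open>K r\<close> is the index of the domino completed to a left stone in the \<open>r\<close>-th pair of rows; it is \<open>0\<close>
  if the left stone of the \<open>r\<close>-th hook lies in the columns. Rows below \<open>- p\<close> meet no hook.
\<close>

definition goes_up :: "int \<Rightarrow> (int \<Rightarrow> int) \<Rightarrow> int \<Rightarrow> int \<Rightarrow> bool" where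
  "goes_up p K i n \<longleftrightarrow> - p \<le> n \<and> even (p - n) \<and> i = K ((p - n + 1) div 2)"

definition goes_right :: "int \<Rightarrow> (int \<Rightarrow> int) \<Rightarrow> int \<Rightarrow> int \<Rightarrow> bool" where
  "goes_right p K i n \<longleftrightarrow> - p \<le> n \<and>
     (if even (p - n) then i < K ((p - n + 1) div 2) else K ((p - n + 1) div 2) \<le> i)"

definition low_tile :: "int \<Rightarrow> int \<Rightarrow> (int \<Rightarrow> int) \<Rightarrow> int \<Rightarrow> int \<Rightarrow> (int \<times> int) set" where
  "low_tile p q K i n =
     (if goes_up p K i n then ltile (n - p + q + 3 * i - 2) n
      else if goes_right p K i n then htile (n - p + q + 3 * i - 2) n
      else htile (n - p + q + 3 * i - 3) n)"

definition low_tiles :: "int \<Rightarrow> int \<Rightarrow> (int \<Rightarrow> int) \<Rightarrow> (int \<times> int) set set" where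
  "low_tiles p q K = {low_tile p q K i n |i n. (i, n) \<in> dominoes p q}"

definition low_peak :: "int \<Rightarrow> (int \<Rightarrow> int) \<Rightarrow> int \<Rightarrow> bool" where
  "low_peak p K n \<longleftrightarrow>
     (if n < - p then True else if even (p - n) then K ((p - n + 1) div 2) = 0 else 0 < K ((p - n + 1) div 2))"

lemma row_cases:
  fixes p n :: int
  obtains m where "n = p - 2 * m" | m where "n = p - 2 * m + 1"
proof (cases "even (p - n)")
  case True
  then obtain m where "p - n = 2 * m" by blast
  then show ?thesis using that(1)[of m] by simp
next
  case False
  then obtain m where "p - n = 2 * m + 1" using oddE by blast
  then show ?thesis using that(2)[of "m + 1"] by simp
qed

lemma goes_even:
  "goes_up p K i (p - 2 * m) \<longleftrightarrow> m \<le> p \<and> i = K m"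
  "goes_right p K i (p - 2 * m) \<longleftrightarrow> m \<le> p \<and> i < K m"
  "low_peak p K (p - 2 * m) \<longleftrightarrow> p < m \<or> K m = 0"
  by (auto simp: goes_up_def goes_right_def low_peak_def)

lemma goes_odd:
  "\<not> goes_up p K i (p - 2 * m + 1)"
  "goes_right p K i (p - 2 * m + 1) \<longleftrightarrow> m \<le> p \<and> K m \<le> i"
  "low_peak p K (p - 2 * m + 1) \<longleftrightarrow> p < m \<or> 0 < K m"
  by (auto simp: goes_up_def goes_right_def low_peak_def)

lemma mem_low_tile:
  "(x, y) \<in> low_tile p q K i n \<longleftrightarrow>
     (y = n \<and> (x = n - p + q + 3 * i - 1 \<or> x = n - p + q + 3 * i - 2)) \<or>
     (y = n + 1 \<and> x = n - p + q + 3 * i - 2 \<and> goes_up p K i n) \<or>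
     (y = n \<and> x = n - p + q + 3 * i \<and> \<not> goes_up p K i n \<and> goes_right p K i n) \<or>
     (y = n \<and> x = n - p + q + 3 * i - 3 \<and> \<not> goes_up p K i n \<and> \<not> goes_right p K i n)"
  unfolding low_tile_def by auto

text \<open>\<open>K_zero\<close> matters for \<open>r = p = q + 1\<close>, the pair of rows past
  the last hook: row \<open>- p\<close> then goes left and row \<open>1 - p\<close> right.\<close>

locale block_data =
  fixes p q :: int and K :: "int \<Rightarrow> int"
  assumes pq: "1 \<le> p" "1 \<le> q" "p \<le> q + 1" "q \<le> p + 1"
    and K_nonneg: "0 \<le> K r" and K_le: "0 \<le> r \<Longrightarrow> K r \<le> r"
    and K_zero: "p < r \<or> q < r \<Longrightarrow> K r = 0"
begin

lemma low_tile_region: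
  assumes "(i, n) \<in> dominoes p q"
  shows "low_tile p q K i n \<subseteq> region (p + 2 * q) (2 * p + q)"
proof (rule subrelI)
  fix x y assume "(x, y) \<in> low_tile p q K i n"
  moreover have D: "1 \<le> i" "i \<le> p" "1 - q - i \<le> n" "n \<le> p - 2 * i" using assms by (simp_all add: mem_dominoes)
  moreover have "n \<le> p - 2 * i - 1 \<and> i \<le> p - 1" if "goes_right p K i n"
  proof (cases rule: row_cases[of n p])
    case (1 m)
    then show ?thesis using that D K_le[of m] by (simp add: goes_even)
  next
    case (2 m)
    then show ?thesis using that D by (simp add: goes_odd) presburger
  qed
  ultimately show "(x, y) \<in> region (p + 2 * q) (2 * p + q)"
    unfolding mem_low_tile mem_region using pq by (elim disjE conjE) simp_all
qed

lemma low_tile_level: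
  assumes "(x, y) \<in> low_tile p q K i n" "1 \<le> i"
  shows "y - x \<le> p - q"
  using assms unfolding mem_low_tile by auto

text \<open>The residue of \<open>x - y + p - q\<close> modulo 3 separates domino cells from
  singles. A domino cell determines its tile; a single has three possible tiles, and the direction
  rules never select two of them.\<close>

lemma low_tile_disjoint:
  assumes "(x, y) \<in> low_tile p q K i n" "(x, y) \<in> low_tile p q K j m"
  shows "i = j \<and> n = m"
proof -
  have "\<exists>l. x - y + p - q = 3 * l \<or> x - y + p - q = 3 * l - 1 \<or> x - y + p - q = 3 * l - 2" by presburger
  then obtain l where l: "x - y + p - q = 3 * l \<or> x - y + p - q = 3 * l - 1 \<or> x - y + p - q = 3 * l - 2" by blast
  show ?thesis
  proof (cases "x - y + p - q = 3 * l")
    case False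
    then have D: "i = l \<and> n = y" if "(x, y) \<in> low_tile p q K i n" for i n
      using that l unfolding mem_low_tile by (auto; presburger)
    show ?thesis using D[OF assms(1)] D[OF assms(2)] by blast
  next
    case True
    then have S: "(i = l + 1 \<and> n = y - 1 \<and> goes_up p K (l + 1) (y - 1)) \<or>
        (i = l \<and> n = y \<and> goes_right p K l y) \<or>
        (i = l + 1 \<and> n = y \<and> \<not> goes_up p K (l + 1) y \<and> \<not> goes_right p K (l + 1) y)"
      if "(x, y) \<in> low_tile p q K i n" for i n
    proof -
      have "y = n \<and> (3 * l = 3 * i - 1 \<or> 3 * l = 3 * i - 2) \<or>
         (n = y - 1 \<and> 3 * i = 3 * (l + 1) \<and> goes_up p K i n) \<or>
         (n = y \<and> 3 * i = 3 * l \<and> goes_right p K i n) \<or>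
         (n = y \<and> 3 * i = 3 * (l + 1) \<and> \<not> goes_up p K i n \<and> \<not> goes_right p K i n)"
        using that True unfolding mem_low_tile by (elim disjE conjE) simp_all
      moreover have "3 * l \<noteq> 3 * i - 1" "3 * l \<noteq> 3 * i - 2" by presburger+
      moreover have "3 * i = 3 * (l + 1) \<longleftrightarrow> i = l + 1" "3 * i = 3 * l \<longleftrightarrow> i = l" by presburger+
      ultimately have "(n = y - 1 \<and> i = l + 1 \<and> goes_up p K i n) \<or>
         (n = y \<and> i = l \<and> goes_right p K i n) \<or>
         (n = y \<and> i = l + 1 \<and> \<not> goes_up p K i n \<and> \<not> goes_right p K i n)"
        by blast
      then show ?thesis by (elim disjE conjE) simp_all
    qed
    have "\<not> goes_right p K l y" if "\<not> goes_up p K (l + 1) y" "\<not> goes_right p K (l + 1) y"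
      by (cases rule: row_cases[of y p]) (use that in \<open>auto simp: goes_even goes_odd\<close>)
    moreover have "goes_right p K (l + 1) y \<and> \<not> goes_right p K l y" if "goes_up p K (l + 1) (y - 1)"
    proof (cases rule: row_cases[of "y - 1" p])
      case (1 m)
      then have y: "y = p - 2 * m + 1" by simp
      have "goes_up p K (l + 1) (p - 2 * m)" using that 1 by simp
      then show ?thesis unfolding y by (simp add: goes_even goes_odd)
    next
      case (2 m)
      then show ?thesis using that by (simp only: goes_odd)
    qed
    ultimately show ?thesis using S[OF assms(1)] S[OF assms(2)] by blast
  qed
qed

text \<open>A single is covered from the left, from the right or from below; comparing its index
  with \<open>K m\<close> decides which.\<close>

lemma low_cover:
  assumes "(x, y) \<in> region (p + 2 * q) (2 * p + q)" "y - x < p - q"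
  shows "\<exists>i n. (i, n) \<in> dominoes p q \<and> (x, y) \<in> low_tile p q K i n"
proof -
  define z where "z = x - y + p - q"
  have "\<exists>i. z = 3 * i \<or> z = 3 * i - 1 \<or> z = 3 * i - 2" by presburger
  then obtain i where i: "z = 3 * i \<or> z = 3 * i - 1 \<or> z = 3 * i - 2" by blast
  show ?thesis
  proof (cases "z = 3 * i")
    case False
    then have "(i, y) \<in> dominoes p q" "(x, y) \<in> low_tile p q K i y"
      using i assms by (auto simp: z_def mem_dominoes mem_region mem_low_tile)
    then show ?thesis by blast
  next
    case True
    then have b: "1 \<le> i" "i \<le> p - 1" "- q - i \<le> y" "y \<le> p - 2 * i - 1" and x: "x = y - p + q + 3 * i"
      using assms by (auto simp: z_def mem_region)
    consider "(i, y) \<in> dominoes p q" "\<not> goes_up p K i y" "goes_right p K i y"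
      | "(i + 1, y) \<in> dominoes p q" "\<not> goes_up p K (i + 1) y" "\<not> goes_right p K (i + 1) y"
      | "(i + 1, y - 1) \<in> dominoes p q" "goes_up p K (i + 1) (y - 1)"
    proof (cases rule: row_cases[of y p])
      case (1 m)
      show ?thesis
      proof (cases "m \<le> p \<and> i < K m")
        case True
        then have "m \<le> q" using K_zero[of m] b by force
        then show ?thesis using that(1) 1 True b by (auto simp: goes_even mem_dominoes)
      next
        case False
        then show ?thesis using that(2) 1 b by (auto simp: goes_even mem_dominoes)
      qed
    next
      case (2 m)
      consider "p < m" | "m \<le> p" "K m \<le> i" | "m \<le> p" "K m = i + 1" | "m \<le> p" "i + 1 < K m" by linarith
      then show ?thesis
      proof cases
        case 1
        then show ?thesis using that(2) 2 b by (auto simp: goes_odd mem_dominoes)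
      next
        case *: 2
        then show ?thesis using that(1) 2 b pq by (auto simp: goes_odd mem_dominoes)
      next
        case 3
        then show ?thesis using that(3) 2 b pq by (auto simp: goes_even mem_dominoes)
      next
        case 4
        then show ?thesis using that(2) 2 b K_le[of m] by (auto simp: goes_odd mem_dominoes)
      qed
    qed
    then show ?thesis
    proof cases
      case 1
      then show ?thesis using x by (intro exI[of _ i] exI[of _ y]) (simp add: mem_low_tile)
    next
      case 2
      then show ?thesis using x by (intro exI[of _ "i + 1"] exI[of _ y]) (simp add: mem_low_tile)
    next
      case 3
      then show ?thesis using x by (intro exI[of _ "i + 1"] exI[of _ "y - 1"]) (simp add: mem_low_tile)
    qed
  qed
qed

text \<open>Only the dominoes \<open>(1, n)\<close> and \<open>(1, n - 1)\<close> can reach this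
  single from below.\<close>

lemma low_tile_peak:
  assumes "- q \<le> n" "n \<le> p - 1"
  shows "(\<exists>i m. (i, m) \<in> dominoes p q \<and> (n - p + q, n) \<in> low_tile p q K i m) \<longleftrightarrow> low_peak p K n"
proof -
  have "(\<exists>i m. (i, m) \<in> dominoes p q \<and> (n - p + q, n) \<in> low_tile p q K i m) \<longleftrightarrow>
     ((1, n) \<in> dominoes p q \<and> \<not> goes_up p K 1 n \<and> \<not> goes_right p K 1 n) \<or>
     ((1, n - 1) \<in> dominoes p q \<and> goes_up p K 1 (n - 1))" (is "?l \<longleftrightarrow> ?r")
  proof
    assume ?l
    then obtain i m where im: "(i, m) \<in> dominoes p q" "(n - p + q, n) \<in> low_tile p q K i m" by blast
    then have "1 \<le> i" by (simp add: mem_dominoes)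
    moreover have "i = 1 \<and> m = n \<and> \<not> goes_up p K i m \<and> \<not> goes_right p K i m \<or> i = 1 \<and> m = n - 1 \<and> goes_up p K i m"
    proof -
      have "3 * i = 1 \<or> 3 * i = 2 \<or> i = 0 \<or> (3 * i = 3 \<and> m = n \<and> \<not> goes_up p K i m \<and> \<not> goes_right p K i m) \<or>
        (3 * i = 3 \<and> m = n - 1 \<and> goes_up p K i m)"
        using im(2) unfolding mem_low_tile by (elim disjE conjE) simp_all
      moreover have "3 * i \<noteq> 1" "3 * i \<noteq> 2" by presburger+
      ultimately show ?thesis using \<open>1 \<le> i\<close> by (elim disjE conjE) simp_all
    qed
    ultimately show ?r using im(1) by auto
  next
    assume ?r
    then show ?l
    proof (elim disjE conjE)
      assume "(1, n) \<in> dominoes p q" "\<not> goes_up p K 1 n" "\<not> goes_right p K 1 n"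
      then show ?l by (intro exI[of _ 1] exI[of _ n]) (simp add: mem_low_tile)
    next
      assume "(1, n - 1) \<in> dominoes p q" "goes_up p K 1 (n - 1)"
      then show ?l by (intro exI[of _ 1] exI[of _ "n - 1"]) (simp add: mem_low_tile)
    qed
  qed
  also have "\<dots> \<longleftrightarrow> low_peak p K n"
  proof (cases rule: row_cases[of n p])
    case (1 m)
    have "n - 1 = p - 2 * (m + 1) + 1" using 1 by simp
    then have "\<not> goes_up p K 1 (n - 1)" by (simp only: goes_odd not_False_eq_True)
    then show ?thesis using 1 assms pq K_nonneg[of m] by (auto simp: goes_even mem_dominoes)
  next
    case (2 m)
    have "p < m \<or> K m \<le> 1 \<or> n \<le> p - 2" using K_le[of m] 2 assms by auto
    moreover have "K m = 0 \<or> - q \<le> n - 1" if "m \<le> p"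
      using K_zero[of m] 2 assms that pq by auto
    ultimately show ?thesis using 2 assms pq K_nonneg[of m] by (auto simp: goes_odd goes_even mem_dominoes)
  qed
  finally show ?thesis .
qed

end

text \<open>Rows with a \<open>block_form\<close> agree with \<open>K\<close> directly. The others
  are rim rows, which go left, and for \<open>p = q + 1\<close> the row \<open>- q\<close>, which
  goes right as its peak is not taken from below.\<close>

lemma (in tiling_mod0) low_tiles_subset:
  assumes form: "\<And>s. 1 \<le> s \<Longrightarrow> s \<le> p \<Longrightarrow> s \<le> q \<Longrightarrow> block_form s (p - 2 * s) (K s)"
    and K: "\<And>s. p < s \<or> q < s \<Longrightarrow> K s = 0"
    and noup: "noup (p - 2 * min p q - 1)"
    and pq: "p \<le> q \<or> p = q + 1 \<and> \<not> peak (- q)"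
  shows "low_tiles p q K \<subseteq> T"
proof -
  have top_row: "Rt i (- q)" if "p = q + 1" "(i, - q) \<in> D" for i
  proof (rule rights[of 1 "- q" i])
    show "(1, - q) \<in> D" "1 \<le> i" using that by (auto simp: mem_dominoes)
    have "\<not> peak (- q)" using pq that by linarith
    then show "\<not> Lf 1 (- q)" by (simp add: peak_def)
    have "noup (- q)" using noup that by simp
    moreover have "(l, - q) \<in> D" if "1 \<le> l" "l \<le> i" for l
      using that \<open>(i, - q) \<in> D\<close> by (auto simp: mem_dominoes)
    ultimately show "\<forall>l. 1 \<le> l \<and> l \<le> i \<longrightarrow> \<not> Up l (- q)" unfolding noup_def by blast
  qed (fact that)
  have "low_tile p q K i n \<in> T" if D: "(i, n) \<in> D" for i n
  proof -
    have i: "1 \<le> i" "i \<le> p" "1 - q - i \<le> n" "n \<le> p - 2 * i" using D by (simp_all add: mem_dominoes)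
    consider (blk) "p - 2 * min p q \<le> n" | (rim) "p \<le> q" "n < - p" | (odd) "p = q + 1" "n = - q" | (low) "p = q + 1" "n \<le> - p"
      using pq by fastforce
    then show ?thesis
    proof cases
      case blk
      show ?thesis
      proof (cases rule: row_cases[of n p])
        case (1 m)
        then have "1 \<le> m" "m \<le> p" "m \<le> q" "i \<le> m" using blk i by auto
        then show ?thesis using form[of m] 1 i
          by (auto simp: low_tile_def goes_even block_form_def Lf_def Rt_def Up_def X_def)
      next
        case (2 m)
        then have "1 \<le> m" "m \<le> p" "m \<le> q" "i < m" using blk i by auto
        then show ?thesis using form[of m] 2 i
          by (auto simp: low_tile_def goes_odd block_form_def Lf_def Rt_def Up_def X_def)
      qed
    next
      case rim
      then have "noup n" using noup_rim[OF noup] by simp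
      then have "Lf i n" using rim_row D rim by simp
      then show ?thesis using rim by (simp add: low_tile_def goes_up_def goes_right_def Lf_def X_def)
    next
      case odd
      have "Rt i n" using top_row D odd by simp
      moreover have "n = p - 2 * p + 1" "K p = 0" using odd K[of p] by auto
      then have "\<not> goes_up p K i n" "goes_right p K i n" using i by (simp_all only: goes_odd, simp_all)
      ultimately show ?thesis by (simp add: low_tile_def Rt_def X_def)
    next
      case low
      \<comment> \<open>Row \<open>- q\<close> has gone right and takes every single that a left
        stone of row \<open>- p\<close> could use.\<close>
      have "noup (- p)"
        unfolding noup_def
      proof (intro allI impI notI)
        fix j assume "(j, - p) \<in> D" "Up j (- p)"
        then have "(j - 1, - q) \<in> D" using low q_nonneg by (auto simp: mem_dominoes)
        then have "Rt (j - 1) (- q)" using top_row low by simp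
        then show False using conflicts(5)[of "j - 1" "- p"] \<open>Up j (- p)\<close> low by simp
      qed
      then have "noup n" using noup_rim[of "- p" n] low by simp
      then have "Lf i n" using rim_row D low by simp
      moreover have "\<not> goes_up p K i n \<and> \<not> goes_right p K i n"
      proof (cases "n < - p")
        case True
        then show ?thesis by (simp add: goes_up_def goes_right_def)
      next
        case False
        then have n: "n = p - 2 * p" and "K p = 0" using low K[of p] by auto
        then show ?thesis using i unfolding n goes_even by simp
      qed
      ultimately show ?thesis by (simp add: low_tile_def Lf_def X_def)
    qed
  qed
  then show ?thesis by (auto simp: low_tiles_def)
qed

text \<open>
  The left stone of the \<open>r\<close>-th hook lies in the rows, at domino \<open>e r\<close>, if \<open>e r > 0\<close>, and in the
  columns, at domino \<open>- e r\<close>, if \<open>e r < 0\<close>.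
\<close>

definition positive_part :: "int \<Rightarrow> (int \<Rightarrow> int) \<Rightarrow> int \<Rightarrow> int" where
  "positive_part N e r = (if 1 \<le> r \<and> r \<le> N then max (e r) 0 else 0)"

definition paired_tiles :: "int \<Rightarrow> int \<Rightarrow> (int \<Rightarrow> int) \<Rightarrow> (int \<times> int) set set" where
  "paired_tiles p q e = low_tiles p q (positive_part q e) \<union>
     (`) prod.swap ` low_tiles q p (positive_part q (\<lambda>r. - e r))"

definition hook_data :: "int \<Rightarrow> (int \<Rightarrow> int) set" where
  "hook_data q = PiE {1..q} (\<lambda>r. {- r..r} - {0})"

lemma low_tile_grid: "low_tile p q K i n \<in> grid_tiles"
  unfolding low_tile_def grid_tiles_def by auto

lemma hook_dataD: "e \<in> hook_data q \<Longrightarrow> 1 \<le> r \<Longrightarrow> r \<le> q \<Longrightarrow> - r \<le> e r \<and> e r \<le> r \<and> e r \<noteq> 0"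
  by (force simp: hook_data_def PiE_iff)

text \<open>The two cases \<open>p = q\<close> and \<open>p = q + 1\<close> are the benzels
  \<open>(3 * q, 3 * q)\<close> and \<open>(3 * q + 1, 3 * q + 2)\<close>.\<close>

locale near_regular =
  fixes p q :: int
  assumes pq: "1 \<le> q" "q \<le> p" "p \<le> q + 1"
begin

abbreviation "R \<equiv> region (p + 2 * q) (2 * p + q)"

lemma block_data:
  assumes "e \<in> hook_data q"
  shows "block_data p q (positive_part q e)" "block_data q p (positive_part q (\<lambda>r. - e r))"
proof -
  have "max (e r) 0 \<le> r \<and> max (- e r) 0 \<le> r" if "1 \<le> r" "r \<le> q" for r
    using hook_dataD[OF assms that] that by auto
  then show "block_data p q (positive_part q e)" "block_data q p (positive_part q (\<lambda>r. - e r))"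
    using pq by (unfold_locales, auto simp: positive_part_def)
qed

text \<open>The sign of \<open>e m\<close> decides which half takes which single of the
  \<open>m\<close>-th hook. For \<open>p = q + 1\<close> the single \<open>n = - q\<close> is left
  over and goes to a rim row of the reflected half.\<close>

lemma low_peak_iff:
  assumes e: "e \<in> hook_data q" and n: "- q \<le> n" "n \<le> p - 1"
  shows "low_peak q (positive_part q (\<lambda>r. - e r)) (n - p + q) \<longleftrightarrow> \<not> low_peak p (positive_part q e) n"
proof (cases rule: row_cases[of n p])
  case (1 m)
  then have m: "1 \<le> m" "m \<le> q" and m': "n - p + q = q - 2 * m" using n pq by auto
  show ?thesis
    unfolding m' unfolding 1 goes_even
    using hook_dataD[OF e m] m pq by (auto simp: positive_part_def)
next
  case (2 m)
  then have m: "1 \<le> m" "m \<le> q + 1" and m': "n - p + q = q - 2 * m + 1" using n pq by auto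
  show ?thesis
  proof (cases "m = q + 1")
    case True
    then show ?thesis
      unfolding m' unfolding 2 goes_odd using 2 n pq by (simp add: positive_part_def)
  next
    case False
    then have "m \<le> q" using m by simp
    then show ?thesis
      unfolding m' unfolding 2 goes_odd
      using hook_dataD[OF e m(1)] m pq by (auto simp: positive_part_def)
  qed
qed

text \<open>Each half tiles its own side without overlaps, and \<open>low_peak_iff\<close> divides
  the longest diagonal between them.\<close>

lemma paired_tiling:
  assumes e: "e \<in> hook_data q"
  shows "paired_tiles p q e \<in> grid_tilings R"
proof -
  let ?K = "positive_part q e" and ?K' = "positive_part q (\<lambda>r. - e r)"
  interpret L: block_data p q ?K by (rule block_data[OF e])
  interpret H: block_data q p ?K' by (rule block_data[OF e])
  have R': "prod.swap ` R = region (q + 2 * p) (2 * q + p)"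
    by (simp add: swap_region add.commute)
  have grid: "paired_tiles p q e \<subseteq> grid_tiles"
    unfolding paired_tiles_def low_tiles_def using low_tile_grid swap_grid_tiles by auto
  have sub: "t \<subseteq> R" if "t \<in> paired_tiles p q e" for t
    using that unfolding paired_tiles_def Un_iff
  proof
    assume "t \<in> low_tiles p q ?K"
    then obtain i n where "(i, n) \<in> dominoes p q" "t = low_tile p q ?K i n"
      unfolding low_tiles_def by blast
    then show ?thesis using L.low_tile_region by simp
  next
    assume "t \<in> (`) prod.swap ` low_tiles q p ?K'"
    then obtain i n where "(i, n) \<in> dominoes q p" "t = prod.swap ` low_tile q p ?K' i n"
      by (auto simp: low_tiles_def)
    then have "prod.swap ` t \<subseteq> prod.swap ` R"
      unfolding R' using H.low_tile_region by (simp add: swap_swap_image)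
    then show ?thesis using image_mono[of "prod.swap ` t" "prod.swap ` R" prod.swap] by (simp add: swap_swap_image)
  qed
  have lowE: "\<exists>t\<in>paired_tiles p q e. (x, y) \<in> t" if "(i, n) \<in> dominoes p q" "(x, y) \<in> low_tile p q ?K i n" for x y i n
    using that unfolding paired_tiles_def low_tiles_def by blast
  have highE: "\<exists>t\<in>paired_tiles p q e. (x, y) \<in> t" if "(i, n) \<in> dominoes q p" "(y, x) \<in> low_tile q p ?K' i n" for x y i n
  proof
    show "prod.swap ` low_tile q p ?K' i n \<in> paired_tiles p q e"
      using that(1) unfolding paired_tiles_def low_tiles_def by blast
    show "(x, y) \<in> prod.swap ` low_tile q p ?K' i n" using that(2) by (simp add: mem_swap_image)
  qed
  have cov: "\<exists>t\<in>paired_tiles p q e. (x, y) \<in> t" if xy: "(x, y) \<in> R" for x y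
  proof -
    have yx: "(y, x) \<in> region (q + 2 * p) (2 * q + p)"
      using xy unfolding R'[symmetric] by (simp add: mem_swap_image)
    consider "y - x < p - q" | "x - y < q - p" | "x = y - p + q" by linarith
    then show ?thesis
    proof cases
      case 1
      then obtain i n where "(i, n) \<in> dominoes p q" "(x, y) \<in> low_tile p q ?K i n" using L.low_cover[OF xy] by auto
      then show ?thesis by (rule lowE)
    next
      case 2
      then obtain i n where "(i, n) \<in> dominoes q p" "(y, x) \<in> low_tile q p ?K' i n" using H.low_cover[OF yx] by auto
      then show ?thesis by (rule highE)
    next
      case 3
      then have n: "- q \<le> y" "y \<le> p - 1" "- p \<le> x" "x \<le> q - 1" using xy by (auto simp: mem_region)
      show ?thesis
      proof (cases "low_peak p ?K y")
        case True
        then obtain i m where "(i, m) \<in> dominoes p q" "(y - p + q, y) \<in> low_tile p q ?K i m"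
          using L.low_tile_peak[OF n(1,2)] by auto
        then show ?thesis unfolding 3[symmetric] by (rule lowE)
      next
        case False
        then have "low_peak q ?K' x" using low_peak_iff[OF e n(1,2)] 3 by simp
        then obtain i m where im: "(i, m) \<in> dominoes q p" "(x - q + p, x) \<in> low_tile q p ?K' i m"
          using H.low_tile_peak[OF n(3,4)] by auto
        have "x - q + p = y" using 3 by simp
        with im have "(y, x) \<in> low_tile q p ?K' i m" by simp
        with im(1) show ?thesis by (rule highE)
      qed
    qed
  qed
  have mixed: False if "(i, n) \<in> dominoes p q" "(x, y) \<in> low_tile p q ?K i n"
      "(j, m) \<in> dominoes q p" "(y, x) \<in> low_tile q p ?K' j m" for x y i n j m
  proof -
    have "1 \<le> i" "1 \<le> j" using that by (simp_all add: mem_dominoes)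
    then have x: "x = y - p + q" using L.low_tile_level[OF that(2)] H.low_tile_level[OF that(4)] by simp
    moreover have "(x, y) \<in> R" using L.low_tile_region that by blast
    ultimately have n: "- q \<le> y" "y \<le> p - 1" "- p \<le> x" "x \<le> q - 1" by (auto simp: mem_region)
    have y: "x - q + p = y" using x by simp
    have "low_peak p ?K y" using L.low_tile_peak[OF n(1,2)] that(1,2) unfolding x[symmetric] by auto
    moreover have "low_peak q ?K' x" using H.low_tile_peak[OF n(3,4)] that(3,4) unfolding y by auto
    ultimately show False using low_peak_iff[OF e n(1,2)] x by simp
  qed
  have disj: "s = t" if st: "s \<in> paired_tiles p q e" "t \<in> paired_tiles p q e" "(x, y) \<in> s" "(x, y) \<in> t" for s t x y
  proof -
    have cases: "(\<exists>i n. (i, n) \<in> dominoes p q \<and> s = low_tile p q ?K i n \<and> (x, y) \<in> low_tile p q ?K i n) \<or>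
      (\<exists>i n. (i, n) \<in> dominoes q p \<and> s = prod.swap ` low_tile q p ?K' i n \<and> (y, x) \<in> low_tile q p ?K' i n)"
      if "s \<in> paired_tiles p q e" "(x, y) \<in> s" for s
      using that unfolding paired_tiles_def low_tiles_def by (auto simp: mem_swap_image)
    show ?thesis
      using cases[OF st(1,3)] cases[OF st(2,4)] mixed L.low_tile_disjoint H.low_tile_disjoint by metis
  qed
  have "\<forall>s\<in>paired_tiles p q e. \<forall>t\<in>paired_tiles p q e. s \<inter> t \<noteq> {} \<longrightarrow> s = t"
  proof (intro ballI impI)
    fix s t assume "s \<in> paired_tiles p q e" "t \<in> paired_tiles p q e" "s \<inter> t \<noteq> {}"
    moreover from \<open>s \<inter> t \<noteq> {}\<close> obtain x y where "(x, y) \<in> s" "(x, y) \<in> t" by fastforce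
    ultimately show "s = t" using disj by blast
  qed
  moreover have "R \<subseteq> \<Union>(paired_tiles p q e)"
    using cov by (auto simp: subset_iff)
  ultimately show ?thesis
    unfolding grid_tilings_def mem_Collect_eq using grid sub by simp
qed

lemma paired_tiles_inj: "inj_on (paired_tiles p q) (hook_data q)"
proof (rule inj_onI)
  fix e f assume e: "e \<in> hook_data q" and f: "f \<in> hook_data q" and eq: "paired_tiles p q e = paired_tiles p q f"
  \<comment> \<open>A positive \<open>K r\<close> can be read off the tiling: the tile through
    domino \<open>K r\<close> of row \<open>p - 2 * r\<close> has a cell in the next row, so it is a
    left stone for \<open>K'\<close> as well.\<close>
  have key: "K' r = K r" if T: "T \<in> grid_tilings S" "low_tiles p q K \<subseteq> T" "low_tiles p q K' \<subseteq> T"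
    and r: "1 \<le> K r" "K r \<le> r" "r \<le> p" "2 * r \<le> p + q" for T S p q K K' r
  proof -
    interpret grid_tiling S T using T by unfold_locales
    have D: "(K r, p - 2 * r) \<in> dominoes p q" using r by (simp add: mem_dominoes)
    let ?x = "q - 2 * r + 3 * K r - 1"
    have "low_tile p q K (K r) (p - 2 * r) = low_tile p q K' (K r) (p - 2 * r)"
    proof (rule same_tile)
      show "low_tile p q K (K r) (p - 2 * r) \<in> T" "low_tile p q K' (K r) (p - 2 * r) \<in> T"
        using T D unfolding low_tiles_def by blast+
      show "(?x, p - 2 * r) \<in> low_tile p q K (K r) (p - 2 * r)" "(?x, p - 2 * r) \<in> low_tile p q K' (K r) (p - 2 * r)"
        by (simp_all add: mem_low_tile)
    qed
    moreover have "(?x - 1, p - 2 * r + 1) \<in> low_tile p q K (K r) (p - 2 * r)"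
      using r by (simp add: mem_low_tile goes_even)
    ultimately have "(?x - 1, p - 2 * r + 1) \<in> low_tile p q K' (K r) (p - 2 * r)" by simp
    then show ?thesis by (simp add: mem_low_tile goes_even)
  qed
  have T: "paired_tiles p q e \<in> grid_tilings R" by (rule paired_tiling[OF e])
  have T': "(`) prod.swap ` paired_tiles p q e \<in> grid_tilings (prod.swap ` R)"
    by (rule swap_grid_tilings[OF T])
  have low: "low_tiles p q (positive_part q g) \<subseteq> paired_tiles p q e"
    and high: "low_tiles q p (positive_part q (\<lambda>r. - g r)) \<subseteq> (`) prod.swap ` paired_tiles p q e"
    if "g = e \<or> g = f" for g
  proof -
    have g: "paired_tiles p q g = paired_tiles p q e" using that eq by auto
    show "low_tiles p q (positive_part q g) \<subseteq> paired_tiles p q e"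
      unfolding g[symmetric] unfolding paired_tiles_def by blast
    have "(`) prod.swap ` (`) prod.swap ` low_tiles q p (positive_part q (\<lambda>r. - g r)) \<subseteq> (`) prod.swap ` paired_tiles p q e"
      unfolding g[symmetric] unfolding paired_tiles_def by (intro image_mono Un_upper2)
    then show "low_tiles q p (positive_part q (\<lambda>r. - g r)) \<subseteq> (`) prod.swap ` paired_tiles p q e"
      by (simp add: image_image swap_swap_image)
  qed
  have "e r = f r" if r: "1 \<le> r" "r \<le> q" for r
  proof (cases "0 < e r")
    case True
    have "positive_part q f r = positive_part q e r"
      using key[OF T low[of e] low[of f], of r] True hook_dataD[OF e r] r pq by (simp add: positive_part_def)
    then show ?thesis using True r by (simp add: positive_part_def split: if_splits)
  next
    case False
    have "positive_part q (\<lambda>r. - f r) r = positive_part q (\<lambda>r. - e r) r"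
      using key[OF T' high[of e] high[of f], of r] False hook_dataD[OF e r] r pq by (simp add: positive_part_def)
    then show ?thesis using False hook_dataD[OF e r] r by (simp add: positive_part_def max_def split: if_splits)
  qed
  then show "e = f" using e f unfolding hook_data_def by (intro PiE_ext[of e _ _ f]) auto
qed

lemma tiling_is_paired:
  assumes "T \<in> grid_tilings R"
  shows "\<exists>e\<in>hook_data q. T = paired_tiles p q e"
proof -
  have t0: "tiling_mod0 p q T" using assms pq by unfold_locales auto
  interpret mirrored_tiling_mod0 p q T
    using t0 tiling_mod0_swap[OF t0] by (rule mirrored_tiling_mod0.intro)
  have B: "L.noup (p - 2 * q - 1)" "H.noup (- q - 1)"
    and "\<forall>s. 1 \<le> s \<and> s \<le> q \<longrightarrow> (\<exists>k k'. 0 \<le> k \<and> k \<le> s \<and> 0 \<le> k' \<and> k' \<le> s \<and>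
        L.block_form s (p - 2 * s) k \<and> H.block_form s (q - 2 * s) k' \<and> (k = 0 \<longleftrightarrow> k' \<noteq> 0))"
    using blocks[of q] pq by auto
  then obtain k k' where k: "\<And>s. 1 \<le> s \<Longrightarrow> s \<le> q \<Longrightarrow> 0 \<le> k s \<and> k s \<le> s \<and> 0 \<le> k' s \<and> k' s \<le> s \<and>
        L.block_form s (p - 2 * s) (k s) \<and> H.block_form s (q - 2 * s) (k' s) \<and> (k s = 0 \<longleftrightarrow> k' s \<noteq> 0)"
    by metis
  \<comment> \<open>Exactly one of \<open>k s\<close> and \<open>k' s\<close> vanishes, so the
    difference is nonzero and its positive and negative parts recover both.\<close>
  define e where "e = restrict (\<lambda>s. k s - k' s) {1..q}"
  have e: "e \<in> hook_data q"
    using k unfolding e_def hook_data_def by (intro restrict_PiE_iff[THEN iffD2]) force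
  have pos: "positive_part q e s = k s" "positive_part q (\<lambda>r. - e r) s = k' s" if "1 \<le> s" "s \<le> q" for s
    using k[OF that] that by (auto simp: positive_part_def e_def)
  \<comment> \<open>This single is taken from the other side, by the rim row \<open>- q - 1\<close>
    of the reflected tiling.\<close>
  have np: "\<not> L.peak (- q)" if "p = q + 1"
  proof
    assume "L.peak (- q)"
    have "(1, - q - 1) \<in> H.D" using pq that by (simp add: mem_dominoes)
    then have "H.Lf 1 (- q - 1)" using H.rim_row[OF B(2)] by simp
    then have "H.peak (- q - 1)" by (simp add: H.peak_def)
    moreover have eq: "- q - p + q = - q - 1" using that by simp
    ultimately show False using peaks[OF \<open>L.peak (- q)\<close>] unfolding eq by blast
  qed
  have min: "min p q = q" "min q p = q" using pq by simp_all
  have low: "low_tiles p q (positive_part q e) \<subseteq> T"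
  proof (rule L.low_tiles_subset)
    show "L.block_form s (p - 2 * s) (positive_part q e s)" if "1 \<le> s" "s \<le> q" for s
      using k[OF that] pos[OF that] by simp
    show "positive_part q e s = 0" if "p < s \<or> q < s" for s
      using that pq by (auto simp: positive_part_def)
    show "L.noup (p - 2 * min p q - 1)" using B(1) by (simp only: min)
    show "p \<le> q \<or> p = q + 1 \<and> \<not> L.peak (- q)"
      using np pq by linarith
  qed
  have "low_tiles q p (positive_part q (\<lambda>r. - e r)) \<subseteq> (`) prod.swap ` T"
  proof -
    define K' where "K' = positive_part q (\<lambda>r. - e r)"
    have "H.block_form s (q - 2 * s) (K' s)" if "1 \<le> s" "s \<le> q" for s
      using k[OF that] pos[OF that] by (simp add: K'_def)
    moreover have "K' s = 0" if "q < s \<or> p < s" for s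
      using that pq by (elim disjE) (simp_all add: K'_def positive_part_def)
    moreover have "H.noup (q - 2 * min q p - 1)" unfolding min using B(2) by simp
    ultimately have "low_tiles q p K' \<subseteq> (`) prod.swap ` T" using H.low_tiles_subset[of K'] pq(2) by blast
    then show ?thesis by (simp only: K'_def)
  qed
  then have "(`) prod.swap ` low_tiles q p (positive_part q (\<lambda>r. - e r)) \<subseteq> (`) prod.swap ` (`) prod.swap ` T"
    by (rule image_mono)
  then have sub: "paired_tiles p q e \<subseteq> T"
    using low by (simp add: paired_tiles_def image_image swap_swap_image)
  \<comment> \<open>The smaller set already covers the region, so no tile of \<open>T\<close> can be
    additional.\<close>
  have "T \<subseteq> paired_tiles p q e"
  proof
    fix t assume t: "t \<in> T"
    then obtain c where c: "c \<in> t"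
      by (cases rule: L.tile_cases) (auto simp: htile_def vtile_def ltile_def)
    then have "c \<in> R" using L.mem_R t by blast
    moreover have "R \<subseteq> \<Union>(paired_tiles p q e)" using paired_tiling[OF e] by (simp add: grid_tilings_def)
    ultimately obtain s where "s \<in> paired_tiles p q e" "c \<in> s" by blast
    then show "t \<in> paired_tiles p q e" using L.same_tile[OF t _ c] sub by blast
  qed
  then show ?thesis using sub e by blast
qed

lemma card_hook_data: "card (hook_data q) = 2 ^ nat q * fact (nat q)"
proof -
  have "card (hook_data q) = (\<Prod>r\<in>{1..q}. card ({- r..r} - {0::int}))"
    unfolding hook_data_def by (simp add: card_PiE)
  also have "\<dots> = (\<Prod>r\<in>{1..q}. nat (2 * r))"
    by (rule prod.cong) (simp_all add: card_Diff_singleton)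
  also have "\<dots> = (\<Prod>r\<in>{1..nat q}. 2 * r)"
    by (rule prod.reindex_bij_witness[of _ int nat]) (auto simp: nat_mult_distrib)
  also have "\<dots> = 2 ^ nat q * fact (nat q)"
    by (simp add: prod.distrib fact_prod)
  finally show ?thesis .
qed

lemma card_grid_tilings:
  "finite (grid_tilings R)" "card (grid_tilings R) = 2 ^ nat q * fact (nat q)"
proof -
  have eq: "grid_tilings R = paired_tiles p q ` hook_data q"
    using tiling_is_paired paired_tiling by blast
  show "finite (grid_tilings R)" unfolding eq hook_data_def by (intro finite_imageI finite_PiE) auto
  show "card (grid_tilings R) = 2 ^ nat q * fact (nat q)"
    unfolding eq by (simp add: card_image paired_tiles_inj card_hook_data)
qed

end

section \<open>Counting the tilings\<close>

lemma double_fact_even: "double_fact (2 * k) = 2 ^ k * fact k"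
  by (induction k) (simp_all add: algebra_simps)

lemma finite_card_tilings:
  fixes a b n :: int
  assumes "2 \<le> a" and n: "(a, b) = (3 * n, 3 * n) \<or> (a, b) = (3 * n + 1, 3 * n + 2)"
  shows "finite (tilings {left_stone, rising_bone, falling_bone} (benzel a b)) \<and>
    card (tilings {left_stone, rising_bone, falling_bone} (benzel a b)) = 2 ^ nat n * fact (nat n)"
proof -
  \<comment> \<open>Chosen so that \<open>a = p + 2 * n\<close> and \<open>b = 2 * p + n\<close>; it
    equals \<open>n\<close> or \<open>n + 1\<close> in the two families.\<close>
  define p where "p = b - a + n"
  have p: "1 \<le> n" "n \<le> p" "p \<le> n + 1" and ab: "a = p + 2 * n" "b = 2 * p + n"
    using assms by (auto simp: p_def)
  interpret near_regular p n using p by unfold_locales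
  have le: "a \<le> 2 * b" "b \<le> 2 * a" using p ab by auto
  have "finite (grid_tilings (region a b))" "card (grid_tilings (region a b)) = 2 ^ nat n * fact (nat n)"
    using card_grid_tilings unfolding ab by blast+
  then show ?thesis
    unfolding card_tilings[OF le] by (simp add: tilings_eq[OF le])
qed

lemma no_tilings:
  fixes a b :: int
  assumes "2 \<le> a" "a \<le> b" "b \<le> 2 * a"
    and n: "\<nexists>n::int. (a, b) = (3 * n, 3 * n) \<or> (a, b) = (3 * n + 1, 3 * n + 2)"
  shows "grid_tilings (region a b) = {}"
proof (rule ccontr)
  assume "grid_tilings (region a b) \<noteq> {}"
  then obtain T where T: "T \<in> grid_tilings (region a b)" by blast
  have "(a + b) mod 3 = 0 \<or> (a + b) mod 3 = 1 \<or> (a + b) mod 3 = 2" by presburger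
  then consider (0) "(a + b) mod 3 = 0" | (1) "(a + b) mod 3 = 1" | (2) "(a + b) mod 3 = 2" by blast
  then show False
  proof cases
    case 0
    \<comment> \<open>The solution of \<open>a = p + 2 * q\<close>, \<open>b = 2 * p + q\<close>,
      integral because 3 divides \<open>a + b\<close>.\<close>
    define p q where "p = (2 * b - a) div 3" and "q = (2 * a - b) div 3"
    have ab: "a = p + 2 * q" "b = 2 * p + q" using 0 unfolding p_def q_def by presburger+
    have pq: "0 \<le> q" "q \<le> p" using assms ab by auto
    have "tiling_mod0 p q T" using T pq unfolding ab by unfold_locales auto
    then interpret mirrored_tiling_mod0 p q T
      using tiling_mod0_swap by (intro mirrored_tiling_mod0.intro)
    have "p \<le> q + 1" using upper_bound assms ab by simp
    then have "(a, b) = (3 * q, 3 * q) \<or> (a, b) = (3 * q + 1, 3 * q + 2)" using pq ab by auto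
    then show False using n by blast
  next
    case 1
    then have "a + b = 3 * ((a + b) div 3) + 1" by presburger
    then show False using no_tiling_mod1[OF _ _ _ _ _ T] assms by auto
  next
    case 2
    define p q where "p = (2 * b - a - 1) div 3" and "q = (2 * a - b - 1) div 3"
    have ab: "a = p + 2 * q + 1" "b = 2 * p + q + 1" using 2 unfolding p_def q_def by presburger+
    have "1 \<le> p" "0 \<le> q" "q \<le> p" using assms ab by auto
    then show False using no_tiling_mod2 T unfolding ab by blast
  qed
qed

theorem theorem1p2:
  fixes a b :: int
  assumes "2 \<le> a" and "a \<le> b" and "b \<le> 2 * a"
  shows "(\<forall>n::int. (a, b) = (3 * n, 3 * n) \<or> (a, b) = (3 * n + 1, 3 * n + 2) \<longrightarrow>
            finite (tilings {left_stone, rising_bone, falling_bone} (benzel a b)) \<and>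
            card (tilings {left_stone, rising_bone, falling_bone} (benzel a b))
              = double_fact (nat (2 * n)) \<and>
            double_fact (nat (2 * n)) = 2 ^ nat n * fact (nat n)) \<and>
         ((\<nexists>n::int. (a, b) = (3 * n, 3 * n) \<or> (a, b) = (3 * n + 1, 3 * n + 2)) \<longrightarrow>
            tilings {left_stone, rising_bone, falling_bone} (benzel a b) = {})"
proof (intro conjI allI impI)
  fix n :: int
  assume n: "(a, b) = (3 * n, 3 * n) \<or> (a, b) = (3 * n + 1, 3 * n + 2)"
  then have "nat (2 * n) = 2 * nat n" using assms by auto
  then show d: "double_fact (nat (2 * n)) = 2 ^ nat n * fact (nat n)" by (simp add: double_fact_even)
  show "finite (tilings {left_stone, rising_bone, falling_bone} (benzel a b))"
    and "card (tilings {left_stone, rising_bone, falling_bone} (benzel a b)) = double_fact (nat (2 * n))"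
    using finite_card_tilings[OF assms(1) n] d by simp_all
next
  assume "\<nexists>n::int. (a, b) = (3 * n, 3 * n) \<or> (a, b) = (3 * n + 1, 3 * n + 2)"
  then have "grid_tilings (region a b) = {}" using no_tilings assms by blast
  moreover have "a \<le> 2 * b" "b \<le> 2 * a" using assms by simp_all
  ultimately show "tilings {left_stone, rising_bone, falling_bone} (benzel a b) = {}"
    by (simp add: tilings_eq)
qed

end
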